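(* Let $n$ be an integer greater than $15$ and let $k$ be an odd integer with $1<k<\sqrt n$. Let $L$ be a $\mathbb{Z}$-lattice with $\min(L)\ge 2$. If there is a representation $\phi:A_{n,k}\to L$, then $R_L(\phi(A_{n-1}))$ is isometric to the root lattice $A_{m-1}$ for some integer $m\ge n$.
   Context: All $\mathbb{Z}$-lattices are positive definite with integral Gram matrix; a representation $\phi:M\to L$ is a linear map with $Q(\phi(x))=Q(x)$; $\min(L)=\min\{Q(x):0\ne x\in L\}$. $I_n=\mathbb{Z}e_1+\dots+\mathbb{Z}e_n$ with $B(e_i,e_j)=\delta_{ij}$. $A_{n,k}=\mathbb{Z}(-e_1+e_2)+\dots+\mathbb{Z}(-e_{n-1}+e_n)+\mathbb{Z}(-(e_{n-k+1}+\dots+e_n))\subset I_n$, and $A_{n-1}$ denotes its sublattice $\mathbb{Z}(-e_1+e_2)+\dots+\mathbb{Z}(-e_{n-1}+e_n)$. The root lattice $A_{m-1}=\{(a_1,\dots,a_m)\in\mathbb{Z}^m:\sum a_i=0\}$. For a lattice $L$, $R_L$ is the sublattice generated by all vectors of norm $1$ or $2$; it is an orthogonal sum of indecomposable root lattices, and for an indecomposable root sublattice $\ell$ of $L$, $R_L(\ell)$ denotes the indecomposable component of $R_L$ containing $\ell$. *)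

theory Defs
  imports Complex_Main "HOL-Library.Function_Algebras"
begin

definition zscale :: "int \<Rightarrow> 'a::ab_group_add \<Rightarrow> 'a" where
  "zscale k x = (\<Sum>i<nat k. x) - (\<Sum>i<nat (- k). x)"

lemma sum_const_lessThan_add:
  "(\<Sum>i<m + n. x::'a::ab_group_add) = (\<Sum>i<m. x) + (\<Sum>i<n. x)" for m n :: nat
  by (induction n) (simp_all add: algebra_simps)

lemma zscale_diff: "zscale (int m - int n) x = (\<Sum>i<m. x) - (\<Sum>i<n. x)"
proof (cases "n \<le> m")
  case True
  then obtain d where "m = n + d" using le_Suc_ex by blast
  then show ?thesis by (simp add: zscale_def sum_const_lessThan_add)
next
  case False
  then obtain d where "n = m + d" using le_Suc_ex by (metis nat_le_linear)
  then show ?thesis by (simp add: zscale_def sum_const_lessThan_add)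
qed

lemma zscale_of_nat: "zscale (int m) x = (\<Sum>i<m. x)"
  using zscale_diff[of m 0 x] by simp

lemma zscale_add_left: "zscale (k + l) x = zscale k x + zscale l x"
proof -
  obtain a b where k: "k = int a - int b" by (rule int_diff_cases)
  obtain c d where l: "l = int c - int d" by (rule int_diff_cases)
  have kl: "k + l = int (a + c) - int (b + d)" by (simp add: k l)
  show ?thesis
    unfolding kl zscale_diff unfolding k l zscale_diff sum_const_lessThan_add
    by (simp add: algebra_simps)
qed

lemma zscale_add_right: "zscale k (x + y) = zscale k x + zscale k y"
  by (simp add: zscale_def sum.distrib algebra_simps)

lemma zscale_minus_left: "zscale (- k) x = - zscale k x"
  by (simp add: zscale_def)

lemma zscale_zscale: "zscale k (zscale l x) = zscale (k * l) x"
proof -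
  have nat: "zscale (int m) (zscale l x) = zscale (int m * l) x" for m
  proof (induction m)
    case 0
    then show ?case by (simp add: zscale_def)
  next
    case (Suc m)
    have "zscale (int (Suc m)) (zscale l x) = zscale (int m) (zscale l x) + zscale l x"
      unfolding zscale_of_nat by simp
    also have "\<dots> = zscale (int m * l + l) x"
      unfolding Suc.IH zscale_add_left ..
    finally show ?case by (simp add: algebra_simps)
  qed
  show ?thesis
  proof (cases k rule: int_cases2)
    case (nonneg m) then show ?thesis by (simp add: nat)
  next
    case (nonpos m) then show ?thesis by (simp add: nat zscale_minus_left)
  qed
qed

text \<open>Every abelian group is a module over the integers in exactly one way.\<close>

interpretation zmod: module "zscale :: int \<Rightarrow> 'a::ab_group_add \<Rightarrow> 'a"
  by unfold_locales
    (simp_all add: zscale_add_left zscale_add_right zscale_zscale, simp add: zscale_def)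

text \<open>A lattice is a set of vectors inside an ambient abelian group, together with a symmetric
  bilinear form; the values of the form outside that set are irrelevant.\<close>

record 'a zlat =
  vectors :: "'a set"
  form :: "'a \<Rightarrow> 'a \<Rightarrow> int"

definition qnorm :: "'a zlat \<Rightarrow> 'a \<Rightarrow> int" where
  "qnorm L x = form L x x"

text \<open>A free module of finite rank with a positive definite integral form. The form is
  integer-valued by its type, which for a bilinear form is integrality of the Gram matrix.\<close>

definition zlattice :: "'a::ab_group_add zlat \<Rightarrow> bool" where
  "zlattice L \<longleftrightarrow>
     (\<exists>S. finite S \<and> zmod.independent S \<and> vectors L = zmod.span S) \<and>
     (\<forall>x\<in>vectors L. \<forall>y\<in>vectors L. form L x y = form L y x) \<and>
     (\<forall>x\<in>vectors L. \<forall>y\<in>vectors L. \<forall>z\<in>vectors L. form L (x + y) z = form L x z + form L y z) \<and>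
     (\<forall>c. \<forall>x\<in>vectors L. \<forall>y\<in>vectors L. form L (zscale c x) y = c * form L x y) \<and>
     (\<forall>x\<in>vectors L. x \<noteq> 0 \<longrightarrow> qnorm L x > 0)"

text \<open>For a nonzero lattice this infimum of positive integers is attained, so it is a minimum.
  For the zero lattice the value is unspecified.\<close>

definition min_norm :: "'a::ab_group_add zlat \<Rightarrow> int" where
  "min_norm L = Inf {qnorm L x | x. x \<in> vectors L \<and> x \<noteq> 0}"

definition lattice_representation :: "('a::ab_group_add \<Rightarrow> 'b::ab_group_add) \<Rightarrow> 'a zlat \<Rightarrow> 'b zlat \<Rightarrow> bool"
  where
  "lattice_representation \<phi> M L \<longleftrightarrow>
     \<phi> ` vectors M \<subseteq> vectors L \<and>
     (\<forall>x\<in>vectors M. \<forall>y\<in>vectors M. \<phi> (x + y) = \<phi> x + \<phi> y) \<and>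
     (\<forall>c. \<forall>x\<in>vectors M. \<phi> (zscale c x) = zscale c (\<phi> x)) \<and>
     (\<forall>x\<in>vectors M. qnorm L (\<phi> x) = qnorm M x)"

definition isometric :: "'a::ab_group_add zlat \<Rightarrow> 'b::ab_group_add zlat \<Rightarrow> bool" where
  "isometric M L \<longleftrightarrow> (\<exists>\<phi>. lattice_representation \<phi> M L \<and> bij_betw \<phi> (vectors M) (vectors L))"

text \<open>A submodule of a free module of finite rank over the integers is again free of finite rank,
  so freeness need not be demanded here.\<close>

definition sublattice :: "'a::ab_group_add zlat \<Rightarrow> 'a zlat \<Rightarrow> bool" where
  "sublattice N L \<longleftrightarrow> zmod.subspace (vectors N) \<and> vectors N \<subseteq> vectors L \<and> form N = form L"

definition generated_sublattice :: "'a::ab_group_add zlat \<Rightarrow> 'a set \<Rightarrow> 'a zlat" where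
  "generated_sublattice L S = L\<lparr>vectors := zmod.span S\<rparr>"

definition orthogonal_in :: "'a zlat \<Rightarrow> 'a zlat \<Rightarrow> 'a zlat \<Rightarrow> bool" where
  "orthogonal_in L M N \<longleftrightarrow> (\<forall>x\<in>vectors M. \<forall>y\<in>vectors N. form L x y = 0)"

definition indecomposable :: "'a::ab_group_add zlat \<Rightarrow> bool" where
  "indecomposable L \<longleftrightarrow>
     vectors L \<noteq> {0} \<and>
     \<not> (\<exists>M N. sublattice M L \<and> sublattice N L \<and> vectors M \<noteq> {0} \<and> vectors N \<noteq> {0} \<and>
            orthogonal_in L M N \<and> vectors L = zmod.span (vectors M \<union> vectors N))"

text \<open>The sum of orthogonal sublattices is automatically direct in a positive definite lattice.\<close>

definition indecomposable_decomposition :: "'a::ab_group_add zlat \<Rightarrow> 'a zlat set \<Rightarrow> bool" where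
  "indecomposable_decomposition L D \<longleftrightarrow>
     finite D \<and>
     (\<forall>M\<in>D. sublattice M L \<and> indecomposable M) \<and>
     (\<forall>M\<in>D. \<forall>N\<in>D. M \<noteq> N \<longrightarrow> orthogonal_in L M N) \<and>
     vectors L = zmod.span (\<Union>M\<in>D. vectors M)"

definition indecomposable_component :: "'a::ab_group_add zlat \<Rightarrow> 'a zlat \<Rightarrow> bool" where
  "indecomposable_component M L \<longleftrightarrow> (\<exists>D. indecomposable_decomposition L D \<and> M \<in> D)"

definition root_sublattice :: "'a::ab_group_add zlat \<Rightarrow> 'a zlat" where
  "root_sublattice L = generated_sublattice L {x \<in> vectors L. qnorm L x = 1 \<or> qnorm L x = 2}"

text \<open>\<open>R\<^sub>L(K)\<close>. A positive definite lattice decomposes into indecomposable sublattices in only one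
  way (Eichler), so the description is proper whenever \<open>K\<close> is an indecomposable root sublattice
  of \<open>L\<close>.\<close>

definition root_component :: "'a::ab_group_add zlat \<Rightarrow> 'a set \<Rightarrow> 'a zlat" where
  "root_component L K =
     (THE M. indecomposable_component M (root_sublattice L) \<and> K \<subseteq> vectors M)"

text \<open>\<open>I\<^sub>n\<close>: integer sequences supported on the coordinates 1, ..., n.\<close>

definition I_lat :: "nat \<Rightarrow> (nat \<Rightarrow> int) zlat" where
  "I_lat n = \<lparr>vectors = {x. \<forall>i. i \<notin> {1..n} \<longrightarrow> x i = 0}, form = (\<lambda>x y. \<Sum>i=1..n. x i * y i)\<rparr>"

definition std_vec :: "nat \<Rightarrow> nat \<Rightarrow> int" where
  "std_vec i = (\<lambda>j. if j = i then 1 else 0)"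

text \<open>The sublattice written \<open>A\<^bsub>n-1\<^esub>\<close> of \<open>A\<^bsub>n,k\<^esub>\<close>; the argument is \<open>n\<close>, not the rank.\<close>

definition A_chain :: "nat \<Rightarrow> (nat \<Rightarrow> int) zlat" where
  "A_chain n = generated_sublattice (I_lat n) {- std_vec i + std_vec (i + 1) | i. 1 \<le> i \<and> i < n}"

definition A_nk :: "nat \<Rightarrow> nat \<Rightarrow> (nat \<Rightarrow> int) zlat" where
  "A_nk n k = generated_sublattice (I_lat n)
     ({- std_vec i + std_vec (i + 1) | i. 1 \<le> i \<and> i < n} \<union> {- (\<Sum>i = n - k + 1..n. std_vec i)})"

text \<open>The root lattice \<open>A\<^sub>r\<close>, of rank \<open>r\<close>.\<close>

definition root_lattice_A :: "nat \<Rightarrow> (nat \<Rightarrow> int) zlat" where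
  "root_lattice_A r =
     (I_lat (r + 1))\<lparr>vectors := {a \<in> vectors (I_lat (r + 1)). (\<Sum>i=1..r + 1. a i) = 0}\<rparr>"

end

theory Submission imports Defs begin

text \<open>Let \<open>h\<^sub>i\<close> be the image of \<open>e\<^sub>i - e\<^sub>1\<close>. The \<open>n\<close> vectors \<open>h\<^sub>i\<close> form a regular simplex all of whose
  edges are roots, and a simplex in \<open>L\<close> has bounded size because its vertices are distinct modulo
  \<open>2L\<close>; so extend it to a maximal simplex \<open>H\<close>, of size \<open>m \<ge> n\<close>. The differences of the
  vertices of \<open>H\<close> span a copy of \<open>A\<^bsub>m-1\<^esub>\<close>, and it remains to see that every other root \<open>r\<close> is
  orthogonal to it. Otherwise \<open>r\<close> takes two consecutive values on \<open>H\<close>, on \<open>p\<close> and \<open>q\<close> vertices.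
  Cauchy-Schwarz gives \<open>p q \<le> 2 (p + q)\<close>, so \<open>p\<close> or \<open>q\<close> is at most 2; the value 1 contradicts
  maximality, and the value 2 yields a sublattice of type \<open>D\<close>, which the image of
  \<open>- (e\<^bsub>n-k+1\<^esub> + \<dots> + e\<^sub>n)\<close> excludes, using \<open>k\<close> odd and \<open>k\<^sup>2 < n\<close>.\<close>

section \<open>Preliminaries on integer modules, orthogonal splittings and isometries\<close>

lemma span_Un_subspaces:
  assumes "zmod.subspace M" "zmod.subspace N"
  shows "zmod.span (M \<union> N) = {x + y | x y. x \<in> M \<and> y \<in> N}"
proof -
  have "zmod.span M = M" "zmod.span N = N" using assms zmod.span_eq_iff by blast+
  then show ?thesis by (simp only: zmod.span_Un)
qed

lemma indecomposable_split:
  assumes "indecomposable K" "zmod.subspace M" "zmod.subspace N"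
    and "vectors K = zmod.span (M \<union> N)" "\<And>x y. x \<in> M \<Longrightarrow> y \<in> N \<Longrightarrow> form K x y = 0"
  shows "M = {0} \<or> N = {0}"
proof (rule ccontr)
  let ?M = "K\<lparr>vectors := M\<rparr>" and ?N = "K\<lparr>vectors := N\<rparr>"
  assume "\<not> (M = {0} \<or> N = {0})"
  moreover have "M \<union> N \<subseteq> vectors K" unfolding assms(4) by (rule zmod.span_superset)
  ultimately have "sublattice ?M K \<and> sublattice ?N K \<and> vectors ?M \<noteq> {0} \<and> vectors ?N \<noteq> {0} \<and>
      orthogonal_in K ?M ?N \<and> vectors K = zmod.span (vectors ?M \<union> vectors ?N)"
    using assms(2-5) by (simp add: sublattice_def orthogonal_in_def)
  then show False using assms(1) unfolding indecomposable_def by blast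
qed

lemma zscale_fun: "zscale c x i = c * x i" for x :: "'b \<Rightarrow> int"
proof -
  have *: "(\<Sum>j<m. x) i = int m * x i" for m :: nat
    by (induction m) (simp_all add: algebra_simps)
  show ?thesis
  proof (cases "0 \<le> c")
    case True
    then show ?thesis by (simp add: zscale_def * del: sum_constant)
  next
    case False
    then show ?thesis by (simp add: zscale_def * del: sum_constant)
  qed
qed

lemma sum_fun_apply: "(\<Sum>j\<in>I. f j) i = (\<Sum>j\<in>I. f j i)" for f :: "'c \<Rightarrow> 'b \<Rightarrow> int"
  by (induction I rule: infinite_finite_induct) simp_all

text \<open>The natural map runs from the root lattice into \<open>L\<close>, while the theorem asks
  for the opposite direction. Maps are additive only on \<open>vectors M\<close>, so closure of that
  set is what keeps \<open>g x + g y\<close> in the domain of \<open>f\<close>.\<close>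

lemma isometric_sym:
  assumes "isometric M N" "zmod.subspace (vectors M)"
  shows "isometric N M"
proof -
  obtain f where f: "lattice_representation f M N" "bij_betw f (vectors M) (vectors N)"
    using assms unfolding isometric_def by blast
  define g where "g = inv_into (vectors M) f"
  have bij: "bij_betw g (vectors N) (vectors M)"
    unfolding g_def using f(2) by (rule bij_betw_inv_into)
  have gM: "g y \<in> vectors M" and fg: "f (g y) = y" if "y \<in> vectors N" for y
    using that bij f(2) unfolding g_def by (auto simp: bij_betw_apply bij_betw_inv_into_right)
  have gf: "g (f x) = x" if "x \<in> vectors M" for x
    using that f(2) unfolding g_def by (rule bij_betw_inv_into_left[rotated])
  note F = f(1)[unfolded lattice_representation_def]
  have "g (x + y) = g x + g y" if "x \<in> vectors N" "y \<in> vectors N" for x y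
  proof -
    have "f (g x + g y) = x + y" using F gM fg that by simp
    then show ?thesis using gf gM that zmod.subspace_add[OF assms(2)] by metis
  qed
  moreover have "g (zscale c x) = zscale c (g x)" if "x \<in> vectors N" for c x
  proof -
    have "f (zscale c (g x)) = zscale c x" using F gM fg that by simp
    then show ?thesis using gf gM that zmod.subspace_scale[OF assms(2)] by metis
  qed
  moreover have "qnorm M (g x) = qnorm N x" if "x \<in> vectors N" for x
    using F gM[OF that] fg[OF that] by metis
  ultimately have "lattice_representation g N M"
    using gM unfolding lattice_representation_def by blast
  then show ?thesis using bij unfolding isometric_def by blast
qed

subsection \<open>Lattices without vectors of norm 1\<close>

text \<open>The bound is stated vector by vector because \<open>min_norm\<close> is an infimum,
  which is unspecified for the zero lattice.\<close>

locale lattice_min_two =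
  fixes L :: "'a::ab_group_add zlat"
  assumes zlattice_L: "zlattice L"
    and two_le_qnorm: "\<And>x. x \<in> vectors L \<Longrightarrow> x \<noteq> 0 \<Longrightarrow> 2 \<le> qnorm L x"
begin

abbreviation V :: "'a set" where "V \<equiv> vectors L"
abbreviation B :: "'a \<Rightarrow> 'a \<Rightarrow> int" where "B \<equiv> form L"
abbreviation Q :: "'a \<Rightarrow> int" where "Q \<equiv> qnorm L"

lemma subspace_V: "zmod.subspace V"
  using zlattice_L unfolding zlattice_def by (metis zmod.subspace_span)

lemma V_closed [simp, intro]:
  "0 \<in> V"
  "x \<in> V \<Longrightarrow> y \<in> V \<Longrightarrow> x + y \<in> V"
  "x \<in> V \<Longrightarrow> y \<in> V \<Longrightarrow> x - y \<in> V"
  "x \<in> V \<Longrightarrow> - x \<in> V"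
  "x \<in> V \<Longrightarrow> zscale c x \<in> V"
  using subspace_V
  by (auto intro: zmod.subspace_0 zmod.subspace_add zmod.subspace_diff zmod.subspace_neg
      zmod.subspace_scale)

lemma V_sum [intro]: "(\<And>i. i \<in> I \<Longrightarrow> f i \<in> V) \<Longrightarrow> (\<Sum>i\<in>I. f i) \<in> V"
  using subspace_V by (rule zmod.subspace_sum)

lemma span_subset_V: "S \<subseteq> V \<Longrightarrow> zmod.span S \<subseteq> V"
  by (simp add: subspace_V zmod.span_minimal)

lemma form_commute: "x \<in> V \<Longrightarrow> y \<in> V \<Longrightarrow> B x y = B y x"
  using zlattice_L unfolding zlattice_def by blast

lemma form_add_left [simp]: "x \<in> V \<Longrightarrow> y \<in> V \<Longrightarrow> z \<in> V \<Longrightarrow> B (x + y) z = B x z + B y z"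
  using zlattice_L unfolding zlattice_def by blast

lemma form_scale_left [simp]: "x \<in> V \<Longrightarrow> y \<in> V \<Longrightarrow> B (zscale c x) y = c * B x y"
  using zlattice_L unfolding zlattice_def by blast

lemma form_minus_left [simp]: "x \<in> V \<Longrightarrow> y \<in> V \<Longrightarrow> B (- x) y = - B x y"
  using form_scale_left[of x y "-1"] by simp

lemma form_diff_left [simp]: "x \<in> V \<Longrightarrow> y \<in> V \<Longrightarrow> z \<in> V \<Longrightarrow> B (x - y) z = B x z - B y z"
  using form_add_left[of x "- y" z] by simp

lemma form_zero_left [simp]: "y \<in> V \<Longrightarrow> B 0 y = 0"
  using form_diff_left[of y y y] by simp

lemma form_right [simp]:
  "x \<in> V \<Longrightarrow> y \<in> V \<Longrightarrow> z \<in> V \<Longrightarrow> B x (y + z) = B x y + B x z"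
  "x \<in> V \<Longrightarrow> y \<in> V \<Longrightarrow> z \<in> V \<Longrightarrow> B x (y - z) = B x y - B x z"
  "x \<in> V \<Longrightarrow> y \<in> V \<Longrightarrow> B x (- y) = - B x y"
  "x \<in> V \<Longrightarrow> y \<in> V \<Longrightarrow> B x (zscale c y) = c * B x y"
  "x \<in> V \<Longrightarrow> B x 0 = 0"
  by (simp_all add: form_commute[of x])

lemma form_sum_left: "(\<And>i. i \<in> I \<Longrightarrow> f i \<in> V) \<Longrightarrow> y \<in> V \<Longrightarrow> B (\<Sum>i\<in>I. f i) y = (\<Sum>i\<in>I. B (f i) y)"
proof (induction I rule: infinite_finite_induct)
  case (insert i I)
  then show ?case using V_sum[of I f] by simp
qed simp_all

lemma form_sum_right: "(\<And>i. i \<in> I \<Longrightarrow> f i \<in> V) \<Longrightarrow> y \<in> V \<Longrightarrow> B y (\<Sum>i\<in>I. f i) = (\<Sum>i\<in>I. B y (f i))"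
  using form_sum_left[of I f y] form_commute[of y] V_sum[of I f] by simp

lemma qnorm_eq_0_iff: "x \<in> V \<Longrightarrow> Q x = 0 \<longleftrightarrow> x = 0"
  using two_le_qnorm[of x] by (cases "x = 0") (auto simp: qnorm_def)

lemma qnorm_nonneg: "x \<in> V \<Longrightarrow> 0 \<le> Q x"
  using two_le_qnorm[of x] by (cases "x = 0") (auto simp: qnorm_def)

lemma qnorm_add: "x \<in> V \<Longrightarrow> y \<in> V \<Longrightarrow> Q (x + y) = Q x + Q y + 2 * B x y"
  by (simp add: qnorm_def form_commute[of y x])

lemma qnorm_diff: "x \<in> V \<Longrightarrow> y \<in> V \<Longrightarrow> Q (x - y) = Q x + Q y - 2 * B x y"
  by (simp add: qnorm_def form_commute[of y x])

lemma qnorm_minus: "x \<in> V \<Longrightarrow> Q (- x) = Q x"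
  by (simp add: qnorm_def)

lemma qnorm_scale: "x \<in> V \<Longrightarrow> Q (zscale c x) = c\<^sup>2 * Q x"
  by (simp add: qnorm_def power2_eq_square)

lemma Cauchy_Schwarz:
  assumes "x \<in> V" "y \<in> V"
  shows "(B x y)\<^sup>2 \<le> Q x * Q y"
proof (cases "x = 0")
  case False
  \<comment> \<open>This is \<open>Q x\<close> times the component of \<open>y\<close> orthogonal to
    \<open>x\<close>, the projection with its denominator cleared.\<close>
  have "0 \<le> Q (zscale (Q x) y - zscale (B x y) x)"
    using assms by (intro qnorm_nonneg) auto
  also have "\<dots> = Q x * (Q x * Q y - (B x y)\<^sup>2)"
    using assms by (simp add: qnorm_diff qnorm_scale form_commute[of y x] power2_eq_square algebra_simps)
  finally show ?thesis
    using two_le_qnorm[OF assms(1) False] by (simp add: zero_le_mult_iff)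
qed (use assms in \<open>simp add: qnorm_def\<close>)

lemma orthogonal_span:
  assumes "S \<subseteq> V" "T \<subseteq> V" "\<And>s t. s \<in> S \<Longrightarrow> t \<in> T \<Longrightarrow> B s t = 0"
    and "x \<in> zmod.span S" "y \<in> zmod.span T"
  shows "B x y = 0"
proof -
  have *: "B x t = 0" if "t \<in> T" for t
  proof -
    have t: "t \<in> V" using that assms(2) by blast
    have "zmod.subspace {x \<in> V. B x t = 0}"
      using t by (auto simp: zmod.subspace_def)
    from zmod.span_minimal[OF _ this, of S] show ?thesis using assms that by blast
  qed
  have x: "x \<in> V" using assms(1,4) span_subset_V by blast
  have "zmod.subspace {y \<in> V. B x y = 0}"
    using x by (auto simp: zmod.subspace_def)
  from zmod.span_minimal[OF _ this, of T] show ?thesis using assms * by blast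
qed

subsection \<open>Indecomposable components of the root sublattice\<close>

definition roots :: "'a set" where "roots = {x \<in> V. Q x = 2}"

definition adj :: "('a \<times> 'a) set" where
  "adj = {(r, s). r \<in> roots \<and> s \<in> roots \<and> B r s \<noteq> 0}"

text \<open>The connected component of \<open>r\<close> in the graph that joins nonorthogonal roots;
  these components will generate the indecomposable summands. The closure is reflexive, so
  \<open>r\<close> lies in its class even when it is not a root.\<close>

definition root_class :: "'a \<Rightarrow> 'a set" where "root_class r = adj\<^sup>* `` {r}"

definition class_lattice :: "'a \<Rightarrow> 'a zlat" where
  "class_lattice r = generated_sublattice L (root_class r)"

lemma rootsD: "r \<in> roots \<Longrightarrow> r \<in> V" "r \<in> roots \<Longrightarrow> Q r = 2" "r \<in> roots \<Longrightarrow> r \<noteq> 0"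
  by (auto simp: roots_def qnorm_def)

lemma roots_subset: "roots \<subseteq> V"
  by (auto simp: roots_def)

lemma sym_adj: "sym adj"
  by (auto simp: sym_def adj_def form_commute rootsD)

lemma root_class_refl: "r \<in> root_class r"
  by (simp add: root_class_def)

lemma root_class_subset: "r \<in> roots \<Longrightarrow> root_class r \<subseteq> roots"
proof
  fix s assume "r \<in> roots" "s \<in> root_class r"
  then have "(r, s) \<in> adj\<^sup>*" by (simp add: root_class_def)
  then show "s \<in> roots" using \<open>r \<in> roots\<close> by (induction) (auto simp: adj_def)
qed

lemma root_class_eq: "s \<in> root_class r \<Longrightarrow> root_class s = root_class r"
  using sym_rtrancl[OF sym_adj] unfolding root_class_def sym_def
  by (auto intro: rtrancl_trans)

lemma root_class_adjacent:
  "r \<in> roots \<Longrightarrow> s \<in> root_class r \<Longrightarrow> t \<in> roots \<Longrightarrow> B s t \<noteq> 0 \<Longrightarrow> t \<in> root_class r"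
  using root_class_subset[of r] unfolding root_class_def adj_def
  by (auto intro: rtrancl_into_rtrancl)

lemma root_class_induct [consumes 2, case_names refl step]:
  assumes "s \<in> root_class r" "r \<in> roots" "P r"
    and "\<And>s t. s \<in> roots \<Longrightarrow> t \<in> roots \<Longrightarrow> B s t \<noteq> 0 \<Longrightarrow> t \<in> root_class r \<Longrightarrow> P s \<Longrightarrow> P t"
  shows "P s"
proof -
  have "(r, s) \<in> adj\<^sup>*" using assms(1) by (simp add: root_class_def)
  then show ?thesis
  proof induction
    case (step y z)
    then have "(r, z) \<in> adj\<^sup>*" by simp
    then show ?case using step assms(4)[of y z] by (auto simp: adj_def root_class_def)
  qed (fact assms(3))
qed

text \<open>A norm-2 vector cannot be split orthogonally, because there are no vectors of norm 1.\<close>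

lemma no_orthogonal_split:
  assumes "x \<in> V" "y \<in> V" "B x y = 0" "x + y \<in> roots"
  shows "x = 0 \<or> y = 0"
proof (rule ccontr)
  assume "\<not> (x = 0 \<or> y = 0)"
  then have "2 \<le> Q x" "2 \<le> Q y" using assms two_le_qnorm by auto
  moreover have "Q x + Q y = 2" using assms rootsD(2)[of "x + y"] by (simp add: qnorm_add)
  ultimately show False by simp
qed

text \<open>Walk along nonorthogonal roots starting from \<open>r\<close>. Each new root lies
  entirely in \<open>M\<close> or in \<open>N\<close>, as it has no orthogonal splitting, and
  \<open>N\<close> is ruled out because the previous root is in \<open>M\<close>.\<close>

lemma root_class_not_split:
  assumes r: "r \<in> roots" "r \<in> M"
    and M: "zmod.subspace M" "M \<subseteq> V" and N: "zmod.subspace N" "N \<subseteq> V"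
    and MN: "\<And>x y. x \<in> M \<Longrightarrow> y \<in> N \<Longrightarrow> B x y = 0"
    and sub: "root_class r \<subseteq> zmod.span (M \<union> N)"
  shows "root_class r \<subseteq> M"
proof
  fix s assume "s \<in> root_class r"
  then show "s \<in> M" using r(1)
  proof (induction rule: root_class_induct)
    case (step s t)
    then obtain x y where xy: "x \<in> M" "y \<in> N" "t = x + y"
      using sub span_Un_subspaces[OF M(1) N(1)] by blast
    have "y = 0 \<or> x = 0"
      using no_orthogonal_split[of x y] xy M N MN step by blast
    moreover have "x \<noteq> 0"
      using MN[of s y] step xy by auto
    ultimately show ?case using xy by simp
  qed (fact r)
qed

text \<open>In an orthogonal splitting \<open>r\<close> falls into one summand and takes its whole
  class along. The other summand is then orthogonal to itself, hence zero.\<close>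

lemma indecomposable_class_lattice:
  assumes r: "r \<in> roots"
  shows "indecomposable (class_lattice r)"
proof -
  let ?C = "zmod.span (root_class r)"
  have CV: "?C \<subseteq> V" using root_class_subset[OF r] roots_subset span_subset_V by blast
  have *: "N = {0}"
    if "r \<in> M" "zmod.subspace M" "M \<subseteq> ?C" "zmod.subspace N" "N \<subseteq> ?C"
      "\<And>x y. x \<in> M \<Longrightarrow> y \<in> N \<Longrightarrow> B x y = 0" "?C = zmod.span (M \<union> N)" for M N
  proof -
    have "root_class r \<subseteq> M"
      using that CV by (intro root_class_not_split[OF r, of M N]) (auto simp: zmod.span_base)
    then have "?C \<subseteq> M" using \<open>zmod.subspace M\<close> by (rule zmod.span_minimal)
    then have "x = 0" if "x \<in> N" for x
      using that \<open>N \<subseteq> ?C\<close> CV \<open>\<And>x y. x \<in> M \<Longrightarrow> y \<in> N \<Longrightarrow> B x y = 0\<close>[of x x]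
        qnorm_eq_0_iff[of x] by (auto simp: qnorm_def)
    then show ?thesis using zmod.subspace_0[OF \<open>zmod.subspace N\<close>] by blast
  qed
  have rC: "r \<in> ?C" by (simp add: root_class_refl zmod.span_base)
  show ?thesis
    unfolding indecomposable_def
  proof (intro conjI notI; (elim exE conjE)?)
    assume "vectors (class_lattice r) = {0}"
    then show False using rC rootsD(3)[OF r] by (simp add: class_lattice_def generated_sublattice_def)
  next
    fix M N assume MN: "sublattice M (class_lattice r)" "sublattice N (class_lattice r)"
      "vectors M \<noteq> {0}" "vectors N \<noteq> {0}" "orthogonal_in (class_lattice r) M N"
      "vectors (class_lattice r) = zmod.span (vectors M \<union> vectors N)"
    have sub: "zmod.subspace (vectors M)" "zmod.subspace (vectors N)"
      "vectors M \<subseteq> ?C" "vectors N \<subseteq> ?C" "?C = zmod.span (vectors M \<union> vectors N)"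
      and orth: "\<And>x y. x \<in> vectors M \<Longrightarrow> y \<in> vectors N \<Longrightarrow> B x y = 0"
      using MN by (auto simp: sublattice_def class_lattice_def generated_sublattice_def orthogonal_in_def)
    obtain x y where xy: "x \<in> vectors M" "y \<in> vectors N" "r = x + y"
      using rC sub span_Un_subspaces by blast
    then have "x = 0 \<or> y = 0"
      using no_orthogonal_split[of x y] sub CV r orth by blast
    then have "r \<in> vectors M \<or> r \<in> vectors N" using xy by auto
    then show False
    proof
      assume "r \<in> vectors M"
      then show False using *[of "vectors M" "vectors N"] sub orth MN by blast
    next
      assume "r \<in> vectors N"
      moreover have "B y x = 0" if "x \<in> vectors M" "y \<in> vectors N" for x y
        using orth that sub CV form_commute[of y x] by (metis in_mono)
      ultimately show False using *[of "vectors N" "vectors M"] sub MN by (metis Un_commute)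
    qed
  qed
qed

text \<open>Vectors are compared modulo twice the lattice, a quotient with at most \<open>2 ^ rank\<close> elements.\<close>

lemma ex_parity:
  "\<exists>(P :: 'a \<Rightarrow> 'a set) S. finite S \<and> (\<forall>x. P x \<subseteq> S) \<and>
     (\<forall>x\<in>V. \<forall>y\<in>V. P x = P y \<longrightarrow> (\<exists>z\<in>V. x - y = zscale 2 z))"
proof -
  obtain S where S: "finite S" "V = zmod.span S"
    using zlattice_L unfolding zlattice_def by blast
  have "\<exists>u. x = (\<Sum>v\<in>S. zscale (u v) v)" if "x \<in> V" for x
    using that S zmod.span_finite[OF S(1)] by auto
  then obtain u where u: "\<And>x. x \<in> V \<Longrightarrow> x = (\<Sum>v\<in>S. zscale (u x v) v)" by metis
  \<comment> \<open>The positions of the odd coefficients determine the class of \<open>x\<close>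
    modulo twice the lattice.\<close>
  define P where "P x = {v \<in> S. odd (u x v)}" for x
  have "\<exists>z\<in>V. x - y = zscale 2 z" if xy: "x \<in> V" "y \<in> V" "P x = P y" for x y
  proof -
    have ev: "2 * ((u x v - u y v) div 2) = u x v - u y v" if "v \<in> S" for v
      using xy(3) that unfolding P_def by (intro dvd_mult_div_cancel) auto
    let ?z = "\<Sum>v\<in>S. zscale ((u x v - u y v) div 2) v"
    have "x - y = (\<Sum>v\<in>S. zscale (u x v - u y v) v)"
      using u[OF xy(1)] u[OF xy(2)] by (simp add: zmod.scale_left_diff_distrib sum_subtractf)
    also have "\<dots> = zscale 2 ?z"
      by (simp add: zmod.scale_sum_right ev)
    finally have "x - y = zscale 2 ?z" .
    moreover have "?z \<in> V"
      using S(2) zmod.span_base by (intro V_sum V_closed(5)) auto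
    ultimately show ?thesis by blast
  qed
  moreover have "P x \<subseteq> S" for x by (auto simp: P_def)
  ultimately show ?thesis using S(1) by blast
qed

text \<open>Roots congruent modulo twice the lattice agree up to sign, and there are finitely many
  congruence classes. Finiteness enters because a decomposition must have finitely many
  summands.\<close>

lemma finite_roots: "finite roots"
proof -
  obtain P :: "'a \<Rightarrow> 'a set" and S where P: "finite S" "\<forall>x. P x \<subseteq> S"
    "\<forall>x\<in>V. \<forall>y\<in>V. P x = P y \<longrightarrow> (\<exists>z\<in>V. x - y = zscale 2 z)"
    using ex_parity by blast
  have eq: "s = r \<or> s = - r" if rs: "r \<in> roots" "s \<in> roots" "P r = P s" for r s
  proof -
    have V: "r \<in> V" "s \<in> V" and Q2: "Q r = 2" "Q s = 2" using rs rootsD by auto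
    obtain z where z: "z \<in> V" "r - s = zscale 2 z" using P(3) V rs by blast
    have 1: "Q (r - s) = 4 * Q z" using z by (simp add: qnorm_scale)
    have 2: "0 \<le> Q (r + s)" using V by (simp add: qnorm_nonneg)
    show ?thesis
    proof (cases "z = 0")
      case True
      then show ?thesis using z by simp
    next
      case False
      then have "Q z \<ge> 2" using z two_le_qnorm by simp
      \<comment> \<open>The parallelogram law gives \<open>Q (r - s) + Q (r + s) = 8\<close>, and
        the first term is already at least 8.\<close>
      then have "Q (r + s) = 0" using 1 2 V Q2 by (simp add: qnorm_add qnorm_diff)
      then show ?thesis using V qnorm_eq_0_iff[of "r + s"] by (simp add: add_eq_0_iff)
    qed
  qed
  have "finite {r \<in> roots. P r = p}" for p
  proof (cases "{r \<in> roots. P r = p} = {}")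
    case False
    then obtain r where "r \<in> roots" "P r = p" by blast
    then have "{r \<in> roots. P r = p} \<subseteq> {r, - r}" using eq by auto
    then show ?thesis by (rule finite_subset) simp
  qed (simp only: finite.emptyI)
  then have "finite (\<Union>p\<in>Pow S. {r \<in> roots. P r = p})"
    using P(1) by (intro finite_UN_I) auto
  then show ?thesis by (rule finite_subset[rotated]) (use P(2) in auto)
qed

lemma vectors_root_sublattice: "vectors (root_sublattice L) = zmod.span roots"
proof -
  have "{x \<in> V. Q x = 1 \<or> Q x = 2} = roots"
    using two_le_qnorm by (force simp: roots_def qnorm_def)
  then show ?thesis by (simp add: root_sublattice_def generated_sublattice_def)
qed

lemma form_root_sublattice [simp]: "form (root_sublattice L) = B"
  by (simp add: root_sublattice_def generated_sublattice_def)

lemma class_lattice_simps [simp]: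
  "vectors (class_lattice r) = zmod.span (root_class r)" "form (class_lattice r) = B"
  by (simp_all add: class_lattice_def generated_sublattice_def)

text \<open>Existence for the description in \<open>root_component\<close>: the lattices of all
  classes form a decomposition, since nonorthogonal roots belong to the same class.\<close>

lemma indecomposable_component_class_lattice:
  assumes "r \<in> roots"
  shows "indecomposable_component (class_lattice r) (root_sublattice L)"
proof -
  have "indecomposable_decomposition (root_sublattice L) (class_lattice ` roots)"
    unfolding indecomposable_decomposition_def
  proof (intro conjI ballI impI)
    fix M assume "M \<in> class_lattice ` roots"
    then obtain r where r: "r \<in> roots" "M = class_lattice r" by blast
    then show "indecomposable M" by (simp add: indecomposable_class_lattice)
    show "sublattice M (root_sublattice L)"
      using r root_class_subset
      by (simp add: sublattice_def zmod.span_mono vectors_root_sublattice)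
    fix N assume N: "N \<in> class_lattice ` roots" "M \<noteq> N"
    then obtain s where s: "s \<in> roots" "N = class_lattice s" by blast
    have "B x y = 0" if "x \<in> root_class r" "y \<in> root_class s" for x y
    proof (rule ccontr)
      assume "B x y \<noteq> 0"
      moreover have "y \<in> roots" using that s root_class_subset by blast
      ultimately have "y \<in> root_class r" using root_class_adjacent r that by blast
      then have "root_class r = root_class s" using root_class_eq that by metis
      then show False using N(2) r s by (simp add: class_lattice_def)
    qed
    then show "orthogonal_in (root_sublattice L) M N"
      using orthogonal_span[of "root_class r" "root_class s"] root_class_subset[OF r(1)]
        root_class_subset[OF s(1)] roots_subset
      unfolding orthogonal_in_def r(2) s(2) form_root_sublattice class_lattice_simps
      by (meson subset_trans)
  next
    have "roots \<subseteq> (\<Union>r\<in>roots. zmod.span (root_class r))"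
      using root_class_refl zmod.span_base by blast
    moreover have "(\<Union>r\<in>roots. zmod.span (root_class r)) \<subseteq> zmod.span roots"
      using root_class_subset by (meson UN_least zmod.span_mono)
    ultimately show "vectors (root_sublattice L) = zmod.span (\<Union>M\<in>class_lattice ` roots. vectors M)"
      unfolding vectors_root_sublattice
      by (simp add: image_image zmod.span_minimal zmod.span_mono subset_antisym)
  qed (simp add: finite_roots)
  then show ?thesis using assms unfolding indecomposable_component_def by blast
qed

text \<open>The part of Eichler's uniqueness theorem that concerns a summand containing a root. The
  class of \<open>r\<close> cannot leave \<open>M\<close>, because the other summands are orthogonal
  to \<open>M\<close>. Conversely the roots outside the class are orthogonal to it, so
  \<open>M\<close> splits into \<open>?C\<close> and its intersection with \<open>?R\<close>, and
  the second piece must vanish.\<close>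

lemma indecomposable_component_unique:
  assumes r: "r \<in> roots" and M: "indecomposable_component M (root_sublattice L)" "r \<in> vectors M"
  shows "M = class_lattice r"
proof -
  let ?C = "zmod.span (root_class r)" and ?R = "zmod.span (roots - root_class r)"
  obtain D where D: "indecomposable_decomposition (root_sublattice L) D" "M \<in> D"
    using M unfolding indecomposable_component_def by blast
  note D' = D(1)[unfolded indecomposable_decomposition_def vectors_root_sublattice]
  have RV: "zmod.span roots \<subseteq> V" by (simp add: roots_subset span_subset_V)
  have sub: "zmod.subspace (vectors N)" "vectors N \<subseteq> zmod.span roots" "form N = B" if "N \<in> D" for N
    using D' that unfolding sublattice_def vectors_root_sublattice form_root_sublattice by blast+
  let ?U = "\<Union>N\<in>D - {M}. vectors N"
  have UV: "?U \<subseteq> V" using sub RV by blast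
  have MV: "vectors M \<subseteq> V" using sub D RV by blast
  have MU: "B x y = 0" if "x \<in> vectors M" "y \<in> zmod.span ?U" for x y
  proof (rule orthogonal_span[OF MV UV _ _ that(2)])
    show "x \<in> zmod.span (vectors M)" using that by (simp add: zmod.span_base)
    show "B s t = 0" if "s \<in> vectors M" "t \<in> ?U" for s t
      using D' D(2) that unfolding orthogonal_in_def by fastforce
  qed
  have "vectors M \<union> ?U = (\<Union>N\<in>D. vectors N)" using D(2) by blast
  then have "zmod.span roots = zmod.span (vectors M \<union> ?U)" using D' by metis
  also have "\<dots> = zmod.span (vectors M \<union> zmod.span ?U)"
    unfolding zmod.span_Un zmod.span_span ..
  finally have spanR: "roots \<subseteq> zmod.span (vectors M \<union> zmod.span ?U)"
    using zmod.span_superset by blast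
  have CM: "root_class r \<subseteq> vectors M"
    using root_class_subset[OF r] spanR
    by (intro root_class_not_split[OF r M(2) sub(1)[OF D(2)] MV zmod.subspace_span
          span_subset_V[OF UV] MU]) blast+
  then have CM': "?C \<subseteq> vectors M" using sub(1)[OF D(2)] by (rule zmod.span_minimal)
  have CR: "B x y = 0" if "x \<in> ?C" "y \<in> ?R" for x y
  proof (rule orthogonal_span[OF _ _ _ that])
    show "B s t = 0" if "s \<in> root_class r" "t \<in> roots - root_class r" for s t
      using root_class_adjacent[OF r] that by blast
  qed (use root_class_subset[OF r] roots_subset in blast)+
  \<comment> \<open>The modular law: \<open>?C\<close> lies in \<open>M\<close>, so the
    \<open>?R\<close>-part of a vector of \<open>M\<close> is again in \<open>M\<close>.\<close>
  have split: "\<exists>a\<in>?C. \<exists>b\<in>vectors M \<inter> ?R. x = a + b" if "x \<in> vectors M" for x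
  proof -
    have "root_class r \<union> (roots - root_class r) = roots" using root_class_subset[OF r] by blast
    then have "x \<in> zmod.span (root_class r \<union> (roots - root_class r))" using that sub(2)[OF D(2)] by auto
    then obtain a b where ab: "x = a + b" "a \<in> ?C" "b \<in> ?R" unfolding zmod.span_Un by blast
    then have "b = x - a" by simp
    then have "b \<in> vectors M" using ab CM' that zmod.subspace_diff[OF sub(1)[OF D(2)]] by blast
    then show ?thesis using ab by blast
  qed
  have subN: "zmod.subspace (vectors M \<inter> ?R)" using sub(1)[OF D(2)] by (simp add: zmod.subspace_inter)
  have "vectors M = zmod.span (?C \<union> (vectors M \<inter> ?R))"
    unfolding span_Un_subspaces[OF zmod.subspace_span subN]
    using split CM' zmod.subspace_add[OF sub(1)[OF D(2)]] by blast
  moreover have "indecomposable M" using D' D(2) by blast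
  moreover have "?C \<noteq> {0}"
    using root_class_refl zmod.span_base rootsD(3)[OF r] by blast
  moreover have "form M x y = 0" if "x \<in> ?C" "y \<in> vectors M \<inter> ?R" for x y
    using CR that sub(3)[OF D(2)] by simp
  ultimately have "vectors M \<inter> ?R = {0}"
    using indecomposable_split[OF _ zmod.subspace_span subN, of M] by blast
  then have "vectors M = ?C" using split CM' by force
  then show ?thesis using sub(3)[OF D(2)]
    by (simp add: class_lattice_def generated_sublattice_def)
qed

lemma root_component_eq:
  assumes "r \<in> roots" "r \<in> K" "K \<subseteq> zmod.span (root_class r)"
  shows "root_component L K = class_lattice r"
  unfolding root_component_def
proof (rule the_equality)
  show "indecomposable_component (class_lattice r) (root_sublattice L) \<and> K \<subseteq> vectors (class_lattice r)"
    using assms by (simp add: indecomposable_component_class_lattice)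
  show "M = class_lattice r"
    if "indecomposable_component M (root_sublattice L) \<and> K \<subseteq> vectors M" for M
    using that assms by (intro indecomposable_component_unique) auto
qed

subsection \<open>Regular simplices\<close>

text \<open>Only the edges are constrained. The vertices may have any norms, which makes the notion
  invariant under translation.\<close>

definition simplex :: "'a set \<Rightarrow> bool" where
  "simplex H \<longleftrightarrow> H \<subseteq> V \<and> (\<forall>x\<in>H. \<forall>y\<in>H. x \<noteq> y \<longrightarrow> Q (x - y) = 2)"

definition diffs :: "'a set \<Rightarrow> 'a set" where
  "diffs H = {x - y | x y. x \<in> H \<and> y \<in> H}"

lemma simplexD:
  assumes "simplex H"
  shows "x \<in> H \<Longrightarrow> x \<in> V" "x \<in> H \<Longrightarrow> y \<in> H \<Longrightarrow> x \<noteq> y \<Longrightarrow> Q (x - y) = 2"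
  using assms by (auto simp: simplex_def)

text \<open>Two vertices congruent modulo twice the lattice would give an edge whose norm is
  divisible by 4, but edges have norm 2.\<close>

lemma simplex_card_bounded: "\<exists>N. \<forall>H. simplex H \<longrightarrow> finite H \<and> card H \<le> N"
proof -
  obtain P :: "'a \<Rightarrow> 'a set" and S where P: "finite S" "\<forall>x. P x \<subseteq> S"
    "\<forall>x\<in>V. \<forall>y\<in>V. P x = P y \<longrightarrow> (\<exists>z\<in>V. x - y = zscale 2 z)"
    using ex_parity by blast
  have "finite H \<and> card H \<le> card (Pow S)" if H: "simplex H" for H
  proof -
    have "inj_on P H"
    proof (rule inj_onI, rule ccontr)
      fix x y assume xy: "x \<in> H" "y \<in> H" "P x = P y" "x \<noteq> y"
      have "x \<in> V" "y \<in> V" using simplexD(1)[OF H] xy by blast+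
      then obtain z where z: "z \<in> V" "x - y = zscale 2 z" using P(3) xy(3) by blast
      have "4 * Q z = 2" using simplexD(2)[OF H xy(1,2,4)] z by (simp add: qnorm_scale)
      then show False by presburger
    qed
    moreover have "P ` H \<subseteq> Pow S" using P(2) by auto
    ultimately show ?thesis
      using P(1) by (meson card_inj_on_le finite_Pow_iff inj_on_finite)
  qed
  then show ?thesis by (intro exI[of _ "card (Pow S)"]) simp
qed

lemma maximal_simplex:
  assumes "simplex H0"
  obtains H where "H0 \<subseteq> H" "simplex H" "finite H"
    "\<And>z. z \<notin> H \<Longrightarrow> \<not> simplex (insert z H)"
proof -
  obtain N where N: "\<And>H. simplex H \<Longrightarrow> finite H \<and> card H \<le> N"
    using simplex_card_bounded by blast
  have "\<exists>H. (H0 \<subseteq> H \<and> simplex H) \<and> (\<forall>H'. H0 \<subseteq> H' \<and> simplex H' \<longrightarrow> card H' \<le> card H)"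
    by (rule ex_has_greatest_nat[of _ H0 card "Suc N"]) (use assms N in \<open>auto simp: less_Suc_eq_le\<close>)
  then obtain H where H: "H0 \<subseteq> H" "simplex H"
    "\<And>H'. H0 \<subseteq> H' \<Longrightarrow> simplex H' \<Longrightarrow> card H' \<le> card H" by blast
  have "\<not> simplex (insert z H)" if "z \<notin> H" for z
  proof
    assume "simplex (insert z H)"
    then have "card (insert z H) \<le> card H" using H(1) by (intro H(3)) auto
    then show False using that N[OF H(2)] by simp
  qed
  then show thesis using that H N by blast
qed

lemma simplex_form:
  assumes "simplex H" "x \<in> H" "y \<in> H"
  shows "2 * B x y = Q x + Q y - 2 + (if x = y then 2 else 0)"
proof (cases "x = y")
  case False
  then show ?thesis
    using simplexD[OF assms(1)] assms(2,3) qnorm_diff[of x y] by simp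
qed (simp add: qnorm_def)

text \<open>By \<open>simplex_form\<close>, \<open>2 * B x y\<close> is a function of
  \<open>x\<close> plus a function of \<open>y\<close> plus a diagonal term. The first two
  contribute nothing when the coefficients sum to zero, so the edges behave like differences of an
  orthonormal basis.\<close>

lemma qnorm_simplex_combination:
  assumes H: "simplex H" "finite H" and a: "sum a H = 0"
  shows "Q (\<Sum>x\<in>H. zscale (a x) x) = (\<Sum>x\<in>H. (a x)\<^sup>2)"
proof -
  have V: "x \<in> V" if "x \<in> H" for x using simplexD(1)[OF H(1)] that .
  have "2 * Q (\<Sum>x\<in>H. zscale (a x) x) = (\<Sum>x\<in>H. \<Sum>y\<in>H. a x * a y * (2 * B x y))"
    using V V_sum[of H "\<lambda>x. zscale (a x) x"]
    by (simp add: qnorm_def form_sum_left form_sum_right sum_distrib_left form_commute mult_ac)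
  \<comment> \<open>The constant -2 is assigned to \<open>x\<close>, so that each of the first two
    double sums has \<open>sum a H\<close> as a factor.\<close>
  also have "\<dots> = (\<Sum>x\<in>H. \<Sum>y\<in>H. a x * (Q x - 2) * a y + a x * (a y * Q y) +
      a x * (if x = y then 2 * a y else 0))"
  proof (intro sum.cong refl)
    fix x y assume "x \<in> H" "y \<in> H"
    then show "a x * a y * (2 * B x y) = a x * (Q x - 2) * a y + a x * (a y * Q y) +
        a x * (if x = y then 2 * a y else 0)"
      by (simp only: simplex_form[OF H(1)]) (simp add: algebra_simps)
  qed
  also have "\<dots> = (\<Sum>x\<in>H. a x * (Q x - 2)) * sum a H + sum a H * (\<Sum>y\<in>H. a y * Q y) +
      (\<Sum>x\<in>H. a x * (2 * a x))"
    using H(2) by (simp add: sum.distrib sum_product flip: sum_distrib_left)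
  also have "\<dots> = 2 * (\<Sum>x\<in>H. (a x)\<^sup>2)"
    unfolding a by (simp add: sum_distrib_left power2_eq_square mult_ac)
  finally show ?thesis by simp
qed

text \<open>If \<open>r\<close> takes the values \<open>c\<close> and \<open>c + 1\<close> on a maximal simplex, taking the larger value once
  would allow an extension of the simplex, and taking it twice produces a root system of type
  \<open>D\<close>, with the vectors \<open>t + 2 z\<close> as the doubled standard basis.\<close>

lemma upper_level_card:
  assumes H: "simplex H" "\<And>z. z \<notin> H \<Longrightarrow> \<not> simplex (insert z H)"
    and no_D: "\<And>t. t \<in> V \<Longrightarrow> \<exists>z\<in>H. Q (t + (z + z)) \<noteq> 4"
    and r: "r \<in> roots" and lev: "\<And>x. x \<in> H \<Longrightarrow> B r x = c \<or> B r x = c + 1"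
  shows "card {x \<in> H. B r x = c + 1} \<notin> {1, 2}"
proof
  assume "card {x \<in> H. B r x = c + 1} \<in> {1, 2}"
  note HV = simplexD[OF H(1)]
  have rV: "r \<in> V" "B r r = 2" using rootsD[OF r] by (auto simp: qnorm_def)
  from \<open>card _ \<in> _\<close> consider "card {x \<in> H. B r x = c + 1} = 1" | "card {x \<in> H. B r x = c + 1} = 2"
    by blast
  then show False
  proof cases
    case 1
    then obtain x where x: "{x \<in> H. B r x = c + 1} = {x}" by (auto simp: card_1_singleton_iff)
    then have xH: "x \<in> H" "B r x = c + 1" by auto
    \<comment> \<open>The extra vertex is \<open>x - r\<close>. For \<open>y\<close> on the lower
      level the norm is 2 + 2 - 2, because \<open>B r (x - y) = 1\<close>.\<close>
    have Qz: "Q ((x - r) - y) = 2" if "y \<in> H" for y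
    proof (cases "y = x")
      case True
      then show ?thesis using rV by (simp add: qnorm_minus) (simp add: qnorm_def)
    next
      case False
      then have "B r y = c" using lev that x by blast
      then show ?thesis
        using HV(2)[OF xH(1) that] False rV HV(1)[OF that] HV(1)[OF xH(1)] xH
        by (simp add: qnorm_def form_commute)
    qed
    have "x - r \<notin> H" using Qz[of "x - r"] by (auto simp: qnorm_def)
    moreover have "Q (y - (x - r)) = 2" if "y \<in> H" for y
      using Qz[OF that] qnorm_minus[of "(x - r) - y"] HV(1)[OF that] HV(1)[OF xH(1)] rV by simp
    then have "simplex (insert (x - r) H)"
      using H(1) Qz HV(1)[OF xH(1)] rV unfolding simplex_def by auto
    ultimately show False using H(2) by blast
  next
    case 2
    then obtain x y where xy: "{x \<in> H. B r x = c + 1} = {x, y}" "x \<noteq> y"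
      by (auto simp: card_2_iff)
    then have xyH: "x \<in> H" "y \<in> H" "B r x = c + 1" "B r y = c + 1" by auto
    note V = HV(1)[OF xyH(1)] HV(1)[OF xyH(2)]
    have Qxy: "Q (x - y) = 2" using HV xyH xy(2) by blast
    \<comment> \<open>The vector is \<open>r + x - y\<close> or \<open>r - x + y\<close> when
      \<open>z\<close> is \<open>x\<close> or \<open>y\<close>, with \<open>r\<close> orthogonal to
      the edge. Otherwise it is \<open>r + (z - x) + (z - y)\<close>, of norm 6 - 2 - 2 + 2.\<close>
    have "Q (r - x - y + (z + z)) = 4" if "z \<in> H" for z
    proof -
      have zV: "z \<in> V" using HV(1) that .
      consider "z = x" | "z = y" | "z \<noteq> x" "z \<noteq> y" by blast
      then show ?thesis
      proof cases
        case 3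
        then have "B r z = c" using lev that xy by blast
        then show ?thesis
          using HV(2)[OF that xyH(1) 3(1)] HV(2)[OF that xyH(2) 3(2)] Qxy rV V zV xyH
          by (simp add: qnorm_def form_commute)
      qed (use Qxy rV V zV xyH in \<open>simp_all add: qnorm_def form_commute\<close>)
    qed
    then show False using no_D[of "r - x - y"] V rV by blast
  qed
qed

text \<open>Cauchy-Schwarz for \<open>r\<close> and the vector \<open>v\<close> with weight
  \<open>q\<close> on the upper level and \<open>- p\<close> on the lower one. The weights sum to
  zero, so \<open>Q v = p * q * (p + q)\<close>, while \<open>B r v = p * q\<close>.\<close>

lemma level_cards:
  assumes H: "simplex H" "finite H"
    and r: "r \<in> roots" and lev: "\<And>x. x \<in> H \<Longrightarrow> B r x = c \<or> B r x = c + 1"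
    and p: "p = int (card {x \<in> H. B r x = c + 1})" and q: "q = int (card {x \<in> H. B r x = c})"
    and "0 < p" "0 < q"
  shows "p * q \<le> 2 * (p + q)"
proof -
  let ?S = "{x \<in> H. B r x = c + 1}" and ?T = "{x \<in> H. B r x = c}"
  define a where "a x = (if B r x = c + 1 then q else - p)" for x
  have split: "sum f H = sum f ?S + sum f ?T" for f :: "'a \<Rightarrow> int"
  proof -
    have "H = ?S \<union> ?T" using lev by auto
    then have "sum f H = sum f (?S \<union> ?T)" by simp
    also have "\<dots> = sum f ?S + sum f ?T" using H(2) by (intro sum.union_disjoint) auto
    finally show ?thesis .
  qed
  have "sum a H = 0" unfolding split by (simp add: a_def p q)
  then have "Q (\<Sum>x\<in>H. zscale (a x) x) = (\<Sum>x\<in>H. (a x)\<^sup>2)" by (rule qnorm_simplex_combination[OF H])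
  also have "\<dots> = p * q\<^sup>2 + q * p\<^sup>2" unfolding split by (simp add: a_def p q)
  finally have Qv: "Q (\<Sum>x\<in>H. zscale (a x) x) = p * q\<^sup>2 + q * p\<^sup>2" .
  have V: "zscale (a x) x \<in> V" "x \<in> V" if "x \<in> H" for x using simplexD(1)[OF H(1)] that by auto
  have "B r (\<Sum>x\<in>H. zscale (a x) x) = (\<Sum>x\<in>H. a x * B r x)"
    using V rootsD(1)[OF r] by (simp add: form_sum_right)
  also have "\<dots> = p * q" unfolding split by (simp add: a_def p q algebra_simps)
  moreover have "(\<Sum>x\<in>H. zscale (a x) x) \<in> V" using V(1) by (rule V_sum)
  ultimately have "(p * q)\<^sup>2 \<le> 2 * (p * q\<^sup>2 + q * p\<^sup>2)"
    using Cauchy_Schwarz[of r "\<Sum>x\<in>H. zscale (a x) x"] Qv rootsD[OF r] by simp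
  then have "(p * q) * (p * q) \<le> (p * q) * (2 * (p + q))"
    by (simp add: power2_eq_square algebra_simps)
  moreover have "0 < p * q" using assms by simp
  ultimately show ?thesis by (simp only: mult_le_cancel_left_pos)
qed

text \<open>A root that is not an edge varies by at most 1 on the simplex. If it is not constant,
  both levels have at least three vertices, and the inequality of \<open>level_cards\<close> then
  bounds the whole simplex by 9.\<close>

lemma root_in_diffs_or_orthogonal:
  assumes H: "simplex H" "finite H" "\<And>z. z \<notin> H \<Longrightarrow> \<not> simplex (insert z H)" "10 \<le> card H"
    and no_D: "\<And>t. t \<in> V \<Longrightarrow> \<exists>z\<in>H. Q (t + (z + z)) \<noteq> 4"
    and r: "r \<in> roots" "r \<notin> diffs H" and xy: "x \<in> H" "y \<in> H"
  shows "B r x = B r y"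
proof (rule ccontr)
  assume neq: "B r x \<noteq> B r y"
  note HV = simplexD[OF H(1)]
  have rV: "r \<in> V" "Q r = 2" using rootsD[OF r(1)] by auto
  have le1: "B r u \<le> B r v + 1" if "u \<in> H" "v \<in> H" for u v
  proof (rule ccontr)
    assume n: "\<not> B r u \<le> B r v + 1"
    then have "u \<noteq> v" by auto
    note uv = HV(1)[OF that(1)] HV(1)[OF that(2)] HV(2)[OF that this]
    \<comment> \<open>A gap of 2 or more makes this norm nonpositive, which forces \<open>r\<close>
      to be the edge \<open>u - v\<close>.\<close>
    have "Q (r - (u - v)) = 4 - 2 * (B r u - B r v)"
      using uv rV by (simp add: qnorm_diff[of r])
    moreover have "0 \<le> Q (r - (u - v))" using uv rV by (intro qnorm_nonneg) auto
    ultimately have "Q (r - (u - v)) = 0" using n by presburger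
    then have "r = u - v" using qnorm_eq_0_iff[of "r - (u - v)"] uv rV by auto
    then show False using r(2) that by (auto simp: diffs_def)
  qed
  define c where "c = min (B r x) (B r y)"
  have lev: "B r z = c \<or> B r z = c + 1" if "z \<in> H" for z
    using le1[OF that xy(1)] le1[OF that xy(2)] le1[OF xy(1) that] le1[OF xy(2) that]
      le1[OF xy] le1[OF xy(2,1)] neq unfolding c_def by linarith
  let ?S = "{x \<in> H. B r x = c + 1}" and ?T = "{x \<in> H. B r x = c}"
  have "card ?S \<notin> {1, 2}" by (rule upper_level_card[OF H(1,3) no_D r(1) lev])
  moreover have "card ?T \<notin> {1, 2}"
  proof -
    \<comment> \<open>Negating \<open>r\<close> exchanges the two levels, so the upper-level lemma
      also covers the lower one.\<close>
    have "B (- r) z = - c - 1 \<or> B (- r) z = (- c - 1) + 1" if "z \<in> H" for z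
      using lev[OF that] HV(1)[OF that] rV by auto
    then have "card {x \<in> H. B (- r) x = (- c - 1) + 1} \<notin> {1, 2}"
      using rV by (intro upper_level_card[OF H(1,3) no_D]) (auto simp: roots_def qnorm_minus)
    moreover have "{x \<in> H. B (- r) x = (- c - 1) + 1} = ?T" using HV(1) rV by auto
    ultimately show ?thesis by simp
  qed
  moreover have "x \<in> ?S \<union> ?T" "y \<in> ?S \<union> ?T" "?S \<noteq> {}" "?T \<noteq> {}"
  proof -
    show "x \<in> ?S \<union> ?T" "y \<in> ?S \<union> ?T" using lev xy by auto
    then show "?S \<noteq> {}" "?T \<noteq> {}" using neq unfolding c_def by (auto simp: min_def split: if_splits)
  qed
  then have "0 < card ?S" "0 < card ?T" using H(2) by (simp_all only: card_gt_0_iff) auto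
  ultimately have 3: "3 \<le> int (card ?S)" "3 \<le> int (card ?T)" by auto
  have "card H = card (?S \<union> ?T)" using lev by (intro arg_cong[of _ _ card]) auto
  also have "\<dots> = card ?S + card ?T" using H(2) by (intro card_Un_disjoint) auto
  finally have "10 \<le> int (card ?S) + int (card ?T)" using H(4) by simp
  moreover have "int (card ?S) * int (card ?T) \<le> 2 * (int (card ?S) + int (card ?T))"
    using 3 by (intro level_cards[OF H(1,2) r(1) lev]) auto
  \<comment> \<open>With level sizes \<open>p\<close> and \<open>q\<close>, this reads
    \<open>p * q >= 3 * (p + q) - 9\<close>. Together with \<open>p * q <= 2 * (p + q)\<close> it
    gives \<open>p + q <= 9\<close>; the sizes 3 and 6 still satisfy both, hence the threshold
    10.\<close>
  moreover have "0 \<le> (int (card ?S) - 3) * (int (card ?T) - 3)" using 3 by simp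
  ultimately show False by (simp add: algebra_simps)
qed

text \<open>A root not orthogonal to an edge is itself an edge by \<open>dich\<close>, so the class
  never leaves \<open>diffs H\<close>. Conversely every edge is reached, since edges sharing a
  vertex are not orthogonal.\<close>

lemma span_root_class_simplex:
  assumes H: "simplex H" and ab: "a \<in> H" "b \<in> H" "a \<noteq> b"
    and dich: "\<And>r x y. r \<in> roots \<Longrightarrow> r \<notin> diffs H \<Longrightarrow> x \<in> H \<Longrightarrow> y \<in> H \<Longrightarrow> B r x = B r y"
  shows "a - b \<in> roots" "zmod.span (root_class (a - b)) = zmod.span (diffs H)"
proof -
  let ?C = "root_class (a - b)"
  note HV = simplexD[OF H]
  have diff_root: "x - y \<in> roots" if "x \<in> H" "y \<in> H" "x \<noteq> y" for x y
    using HV that by (simp add: roots_def)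
  then show ab_root: "a - b \<in> roots" using ab .
  have "s \<in> diffs H" if "s \<in> ?C" for s
    using that ab_root
  proof (induction rule: root_class_induct)
    case refl
    show ?case using ab by (auto simp: diffs_def)
  next
    case (step s t)
    then obtain x y where xy: "s = x - y" "x \<in> H" "y \<in> H" by (auto simp: diffs_def)
    have "B t x \<noteq> B t y"
      using step(3) xy HV(1) rootsD(1)[OF step(2)] by (simp add: form_commute[of t])
    then show ?case using dich[OF step(2) _ xy(2,3)] by blast
  qed
  moreover have diff_C: "x - y \<in> ?C" if xy: "x \<in> H" "y \<in> H" "x \<noteq> y" for x y
  proof -
    have turn: "u - z \<in> ?C" if "u - v \<in> ?C" "u \<in> H" "v \<in> H" "z \<in> H" "u \<noteq> v" "u \<noteq> z" for u v z
    proof (rule root_class_adjacent[OF ab_root that(1) diff_root[OF that(2,4,6)]])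
      have "2 * B (u - v) (u - z) = Q (u - v) + Q (u - z) - Q (v - z)"
        using HV(1) that by (simp add: qnorm_def form_commute)
      also have "\<dots> \<noteq> 0" using HV(2) that by (cases "v = z") (auto simp: qnorm_def)
      finally show "B (u - v) (u - z) \<noteq> 0" by simp
    qed
    have flip: "v - u \<in> ?C" if "u - v \<in> ?C" "u \<in> H" "v \<in> H" "u \<noteq> v" for u v
    proof (rule root_class_adjacent[OF ab_root that(1)])
      show "v - u \<in> roots" using diff_root that by blast
      have "B (u - v) (v - u) = - Q (u - v)" using HV(1) that by (simp add: qnorm_def)
      then show "B (u - v) (v - u) \<noteq> 0" using HV(2) that by simp
    qed
    \<comment> \<open>The route from \<open>a - b\<close> to \<open>x - y\<close> goes through
      \<open>a - x\<close> and \<open>x - a\<close>.\<close>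
    show ?thesis
    proof (cases "x = a")
      case True
      then show ?thesis using turn[OF root_class_refl ab(1,2)] ab xy by blast
    next
      case False
      then have "a - x \<in> ?C" using turn[OF root_class_refl ab(1,2)] ab xy by blast
      then have "x - a \<in> ?C" using flip ab xy False by blast
      then show ?thesis using turn ab xy False by blast
    qed
  qed
  have "x - y \<in> zmod.span ?C" if "x \<in> H" "y \<in> H" for x y
    using diff_C[OF that] by (cases "x = y") (simp_all add: zmod.span_base zmod.span_zero)
  then have "zmod.span (diffs H) \<subseteq> zmod.span ?C"
    by (intro zmod.span_minimal) (auto simp: diffs_def)
  ultimately show "zmod.span ?C = zmod.span (diffs H)"
    by (meson subsetI subset_antisym zmod.span_mono)
qed

section \<open>The isometry between the span of the edges and the root lattice\<close>

text \<open>Enumerating the vertices as \<open>h i\<close> sends a coefficient sequence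
  \<open>a\<close> of sum zero to the combination of the \<open>h i\<close>, and
  \<open>qnorm_simplex_combination\<close> says that this preserves norms. Injectivity then follows
  from positivity of the sum of squares.\<close>

lemma isometric_simplex:
  assumes H: "simplex H" "finite H" "H \<noteq> {}" and M: "vectors M = zmod.span (diffs H)" "form M = B"
  shows "isometric M (root_lattice_A (card H - 1))"
proof (rule isometric_sym)
  let ?m = "card H"
  have m: "?m - 1 + 1 = ?m" using H by (simp add: card_gt_0_iff)
  obtain h where h: "bij_betw h {1..?m} H"
    using ex_bij_betw_nat_finite_1[OF H(2)] by blast
  have hH: "h i \<in> H" if "i \<in> {1..?m}" for i using h that by (rule bij_betw_apply)
  have hV: "h i \<in> V" if "i \<in> {1..?m}" for i using simplexD(1)[OF H(1) hH[OF that]] .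
  let ?A = "vectors (root_lattice_A (?m - 1))"
  have A: "?A = {a. (\<forall>i. i \<notin> {1..?m} \<longrightarrow> a i = 0) \<and> (\<Sum>i=1..?m. a i) = 0}"
    by (simp only: root_lattice_A_def I_lat_def m zlat.simps mem_Collect_eq)
  define \<psi> where "\<psi> a = (\<Sum>i=1..?m. zscale (a i) (h i))" for a
  show subA: "zmod.subspace ?A"
    unfolding A by (auto simp: zmod.subspace_def zscale_fun sum.distrib simp flip: sum_distrib_left)
  have add: "\<psi> (a + b) = \<psi> a + \<psi> b" for a b
    by (simp add: \<psi>_def zscale_add_left sum.distrib)
  have scale: "\<psi> (zscale c a) = zscale c (\<psi> a)" for c a
    by (simp add: \<psi>_def zmod.scale_sum_right zscale_fun)
  have im: "\<psi> a \<in> zmod.span (diffs H)" if "a \<in> ?A" for a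
  proof -
    \<comment> \<open>Moving the base point to \<open>h 1\<close> costs a multiple of
      \<open>h 1\<close> by the coefficient sum, which is zero.\<close>
    have "\<psi> a = (\<Sum>i=1..?m. zscale (a i) (h i - h 1)) + zscale (\<Sum>i=1..?m. a i) (h 1)"
      by (simp add: \<psi>_def zmod.scale_right_diff_distrib sum_subtractf zmod.scale_sum_left)
    also have "(\<Sum>i=1..?m. a i) = 0" using that unfolding A by blast
    finally have "\<psi> a = (\<Sum>i=1..?m. zscale (a i) (h i - h 1))" by simp
    moreover have "h i - h 1 \<in> diffs H" if "i \<in> {1..?m}" for i
      using hH[OF that] hH[of 1] that by (auto simp: diffs_def)
    then have "(\<Sum>i=1..?m. zscale (a i) (h i - h 1)) \<in> zmod.span (diffs H)"
      by (intro zmod.span_sum zmod.span_scale zmod.span_base)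
    ultimately show ?thesis by (simp only:)
  qed
  have norm: "Q (\<psi> a) = (\<Sum>i=1..?m. (a i)\<^sup>2)" if "a \<in> ?A" for a
  proof -
    let ?g = "the_inv_into {1..?m} h"
    have g: "?g (h i) = i" if "i \<in> {1..?m}" for i
      using h that by (simp add: bij_betw_def the_inv_into_f_f)
    have tr: "(\<Sum>x\<in>H. F (?g x) x) = (\<Sum>i=1..?m. F i (h i))" for F :: "nat \<Rightarrow> 'a \<Rightarrow> 'c::comm_monoid_add"
    proof -
      have "(\<Sum>x\<in>H. F (?g x) x) = (\<Sum>i=1..?m. F (?g (h i)) (h i))"
        using sum.reindex_bij_betw[OF h, of "\<lambda>x. F (?g x) x"] by (rule sym)
      also have "\<dots> = (\<Sum>i=1..?m. F i (h i))" by (intro sum.cong refl) (simp only: g)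
      finally show ?thesis .
    qed
    have "(\<Sum>x\<in>H. a (?g x)) = 0"
      using that tr[of "\<lambda>i _. a i"] unfolding A by simp
    then have "Q (\<Sum>x\<in>H. zscale (a (?g x)) x) = (\<Sum>x\<in>H. (a (?g x))\<^sup>2)"
      by (rule qnorm_simplex_combination[OF H(1,2)])
    then show ?thesis
      using tr[of "\<lambda>i x. zscale (a i) x"] tr[of "\<lambda>i _. (a i)\<^sup>2"] by (simp add: \<psi>_def)
  qed
  have "lattice_representation \<psi> (root_lattice_A (?m - 1)) M"
    unfolding lattice_representation_def
  proof (intro conjI ballI allI)
    show "\<psi> ` ?A \<subseteq> vectors M" using im M by auto
    show "qnorm M (\<psi> a) = qnorm (root_lattice_A (?m - 1)) a" if "a \<in> ?A" for a
      using norm[OF that] M(2)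
      by (simp only: qnorm_def root_lattice_A_def I_lat_def m zlat.simps power2_eq_square)
  qed (auto simp: add scale)
  moreover have "inj_on \<psi> ?A"
  proof (rule inj_onI)
    fix a b assume ab: "a \<in> ?A" "b \<in> ?A" "\<psi> a = \<psi> b"
    have "a - b \<in> ?A" using ab zmod.subspace_diff[OF subA] by blast
    moreover have "\<psi> (a - b) = 0" using add[of "a - b" b] ab by simp
    ultimately have "(\<Sum>i=1..?m. (a i - b i)\<^sup>2) = 0" using norm[of "a - b"] by (simp add: qnorm_def)
    then have *: "\<forall>i\<in>{1..?m}. (a i - b i)\<^sup>2 = 0"
      by (subst sum_nonneg_eq_0_iff[symmetric]) simp_all
    show "a = b"
    proof
      fix i
      show "a i = b i"
      proof (cases "i \<in> {1..?m}")
        case False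
        then show ?thesis using ab(1,2) unfolding A by simp
      qed (use * in simp)
    qed
  qed
  moreover have "zmod.span (diffs H) \<subseteq> \<psi> ` ?A"
  proof (rule zmod.span_minimal)
    show "zmod.subspace (\<psi> ` ?A)"
      unfolding zmod.subspace_def
    proof (intro conjI ballI allI)
      have "\<psi> 0 = 0" by (simp add: \<psi>_def)
      then show "0 \<in> \<psi> ` ?A" using zmod.subspace_0[OF subA] by (metis image_eqI)
    next
      fix x y assume "x \<in> \<psi> ` ?A" "y \<in> \<psi> ` ?A"
      then obtain a b where "x = \<psi> a" "a \<in> ?A" "y = \<psi> b" "b \<in> ?A" by blast
      then show "x + y \<in> \<psi> ` ?A" using zmod.subspace_add[OF subA] by (metis add image_eqI)
    next
      fix c x assume "x \<in> \<psi> ` ?A"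
      then obtain a where "x = \<psi> a" "a \<in> ?A" by blast
      then show "zscale c x \<in> \<psi> ` ?A" using zmod.subspace_scale[OF subA] by (metis scale image_eqI)
    qed
    show "diffs H \<subseteq> \<psi> ` ?A"
    proof
      fix d assume "d \<in> diffs H"
      then obtain x y where "d = x - y" "x \<in> H" "y \<in> H" by (auto simp: diffs_def)
      then obtain i j where ij: "d = h i - h j" "i \<in> {1..?m}" "j \<in> {1..?m}"
        using h by (metis bij_betw_imp_surj_on imageE)
      \<comment> \<open>A single \<open>std_vec l\<close> lies outside \<open>?A\<close>, but the
        formula for the map makes sense and is additive on all sequences.\<close>
      have \<psi>1: "\<psi> (std_vec l) = h l" if "l \<in> {1..?m}" for l
      proof -
        have "\<psi> (std_vec l) = (\<Sum>i=1..?m. if i = l then h l else 0)"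
          unfolding \<psi>_def by (intro sum.cong) (auto simp: std_vec_def)
        then show ?thesis using that by simp
      qed
      have "\<psi> (std_vec i - std_vec j) = d"
        using add[of "std_vec i - std_vec j" "std_vec j"] \<psi>1 ij by simp
      moreover have "std_vec i - std_vec j \<in> ?A"
        using ij unfolding A by (auto simp: std_vec_def sum_subtractf)
      ultimately show "d \<in> \<psi> ` ?A" by blast
    qed
  qed
  ultimately show "isometric (root_lattice_A (?m - 1)) M"
    using im M unfolding isometric_def bij_betw_def by (intro exI[of _ \<psi>]) auto
qed

subsection \<open>Excluding type D\<close>

text \<open>Serves twice below: with \<open>c = 4\<close> it yields Bessel's inequality, with
  \<open>c = 2\<close> the case of equality.\<close>

lemma orthogonal_frame_qnorm:
  assumes w: "w \<in> V" and J: "finite J" and g: "\<And>i. i \<in> J \<Longrightarrow> g i \<in> V"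
    and gg: "\<And>i j. i \<in> J \<Longrightarrow> j \<in> J \<Longrightarrow> B (g i) (g j) = (if i = j then 4 else 0)"
  shows "Q (zscale c w + (\<Sum>i\<in>J. zscale (u i) (g i))) =
    c\<^sup>2 * Q w + 2 * c * (\<Sum>i\<in>J. u i * B w (g i)) + 4 * (\<Sum>i\<in>J. (u i)\<^sup>2)"
proof -
  let ?s = "\<Sum>i\<in>J. zscale (u i) (g i)"
  have gV: "zscale (u i) (g i) \<in> V" if "i \<in> J" for i using g that by simp
  then have sV: "?s \<in> V" by (rule V_sum)
  have "B ?s (g j) = 4 * u j" if "j \<in> J" for j
  proof -
    have "B ?s (g j) = (\<Sum>i\<in>J. u i * B (g i) (g j))"
      using gV g that by (simp add: form_sum_left)
    also have "\<dots> = (\<Sum>i\<in>J. if i = j then 4 * u j else 0)"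
      using gg that by (intro sum.cong) auto
    finally show ?thesis using J that by simp
  qed
  then have "Q ?s = 4 * (\<Sum>i\<in>J. (u i)\<^sup>2)"
    using gV g sV
    by (simp add: qnorm_def form_sum_right[of J _ ?s] sum_distrib_left power2_eq_square mult_ac)
  moreover have "B w ?s = (\<Sum>i\<in>J. u i * B w (g i))"
    using gV g w by (simp add: form_sum_right)
  ultimately show ?thesis using w sV by (simp add: qnorm_add qnorm_scale)
qed

text \<open>The doubled standard basis \<open>g i\<close> of a component of type \<open>D\<close> is impossible: by Bessel's
  inequality \<open>2 w\<close> would be minus the sum of \<open>k\<close> of the \<open>g i\<close>, and since \<open>k\<close> is odd
  some \<open>g i\<close> would be divisible by 2, giving a vector of norm 1.\<close>

lemma no_doubled_basis:
  fixes h :: "nat \<Rightarrow> 'a" and k n :: nat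
  assumes n: "15 < n" and k: "odd k" "3 \<le> k" "k * k < n"
    and h: "\<And>i. i \<in> {1..n} \<Longrightarrow> h i \<in> V"
      "\<And>i j. i \<in> {1..n} \<Longrightarrow> j \<in> {1..n} \<Longrightarrow> i \<noteq> j \<Longrightarrow> Q (h i - h j) = 2"
    and t: "t \<in> V" "\<And>i. i \<in> {1..n} \<Longrightarrow> Q (t + (h i + h i)) = 4"
    and w: "w \<in> V" "Q w = int k"
      "\<And>i. i \<in> {1..n} \<Longrightarrow> B w (h i) = B w (h 1) - (if n - k < i then 1 else 0)"
  shows False
proof -
  have "k \<le> k * k" using k(2) by simp
  then have kn: "k < n" using k(3) by linarith
  have one: "1 \<in> {1..n}" "\<not> n - k < 1" using n kn by auto
  define g where "g i = t + (h i + h i)" for i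
  have gV: "g i \<in> V" if "i \<in> {1..n}" for i using h t that by (simp add: g_def)
  have gg: "B (g i) (g j) = (if i = j then 4 else 0)" if "i \<in> {1..n}" "j \<in> {1..n}" for i j
  proof (cases "i = j")
    case True
    then show ?thesis using t that by (simp add: g_def qnorm_def)
  next
    case False
    \<comment> \<open>The norm 8 of this difference equals 4 + 4, so distinct \<open>g i\<close> are
      orthogonal.\<close>
    have "g i - g j = zscale 2 (h i - h j)"
      using zscale_add_left[of 1 1 "h i - h j"] by (simp add: g_def algebra_simps)
    then have "Q (g i - g j) = 8" using h that False by (simp add: qnorm_scale)
    then show ?thesis using t(2)[OF that(1)] t(2)[OF that(2)] gV that False
      by (simp add: qnorm_diff flip: g_def)
  qed
  define c where "c = B w (g 1)"
  let ?I = "{1..n - k}" and ?J = "{n - k + 1..n}"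
  have IJ: "{1..n} = ?I \<union> ?J" "?I \<inter> ?J = {}" "?J \<subseteq> {1..n}" using kn by auto
  have card: "card ?I = n - k" "card ?J = k" using kn by auto
  have wg: "B w (g i) = c - (if n - k < i then 2 else 0)" if "i \<in> {1..n}" for i
    using w(3)[OF that] h(1)[OF that] h(1)[OF one(1)] w(1) t(1)
    by (simp add: g_def c_def)
  \<comment> \<open>Since the \<open>g i\<close> have norm 4, this is four times the component of
    \<open>w\<close> orthogonal to all of them.\<close>
  have "0 \<le> Q (zscale 4 w + (\<Sum>i\<in>{1..n}. zscale (- B w (g i)) (g i)))"
    using w gV by (intro qnorm_nonneg V_closed V_sum) auto
  also have "\<dots> = 16 * int k - 4 * (\<Sum>i\<in>{1..n}. (B w (g i))\<^sup>2)"
    using w gV gg by (subst orthogonal_frame_qnorm) (auto simp: sum_negf power2_eq_square)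
  also have "(\<Sum>i\<in>{1..n}. (B w (g i))\<^sup>2) = (\<Sum>i\<in>?I. (B w (g i))\<^sup>2) + (\<Sum>i\<in>?J. (B w (g i))\<^sup>2)"
    unfolding IJ(1) using IJ(2) by (intro sum.union_disjoint) auto
  also have "(\<Sum>i\<in>?I. (B w (g i))\<^sup>2) = (\<Sum>i\<in>?I. c\<^sup>2)"
    using wg kn by (intro sum.cong) auto
  also have "(\<Sum>i\<in>?J. (B w (g i))\<^sup>2) = (\<Sum>i\<in>?J. (c - 2)\<^sup>2)"
    using wg kn by (intro sum.cong) auto
  finally have bessel: "int (n - k) * c\<^sup>2 + int k * (c - 2)\<^sup>2 \<le> 4 * int k"
    unfolding sum_constant card by simp
  consider "c = 0" | "c = 1" | "2 \<le> c" | "c \<le> -1" by linarith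
  then have "c = 0"
  proof cases
    case 2
    \<comment> \<open>For \<open>c = 1\<close> both squares in \<open>bessel\<close> are 1. Then
      \<open>k * k < n <= 4 * k\<close> forces \<open>k < 4\<close>, so \<open>n < 16\<close>; this
      is where the bound 15 on \<open>n\<close> is used.\<close>
    then have "n \<le> 4 * k" using bessel kn by (simp add: of_nat_diff)
    then have "k * k < 4 * k" using k(3) by linarith
    then have "k < 4" by simp
    then show ?thesis using \<open>n \<le> 4 * k\<close> n by linarith
  next
    case 3
    then have "2\<^sup>2 \<le> c\<^sup>2" by (intro power_mono) auto
    then have "int (n - k) * 4 \<le> int (n - k) * c\<^sup>2" by (intro mult_left_mono) auto
    moreover have "0 \<le> int k * (c - 2)\<^sup>2" by simp
    ultimately have "int (n - k) * 4 \<le> 4 * int k" using bessel by linarith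
    then have "n \<le> 2 * k" by linarith
    moreover have "3 * k \<le> k * k" using k(2) by simp
    ultimately show ?thesis using k by linarith
  next
    case 4
    then have "3\<^sup>2 \<le> (2 - c)\<^sup>2" by (intro power_mono) auto
    then have "int k * 9 \<le> int k * (c - 2)\<^sup>2"
      by (intro mult_left_mono) (auto simp: power2_commute)
    moreover have "0 \<le> int (n - k) * c\<^sup>2" by simp
    ultimately have "int k * 9 \<le> 4 * int k" using bessel by linarith
    then show ?thesis using k by linarith
  qed
  let ?s = "\<Sum>i\<in>?J. g i" and ?h = "\<Sum>i\<in>?J. h i"
  have JV: "?s \<in> V" "?h \<in> V" using gV h(1) IJ(3) by (auto intro!: V_sum)
  \<comment> \<open>For \<open>c = 0\<close> Bessel's inequality is an equality, so
    \<open>2 w\<close> is exactly minus the sum of the last \<open>k\<close> vectors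
    \<open>g i\<close>. The norm below is \<open>4 k - 8 k + 4 k\<close>.\<close>
  have "Q (zscale 2 w + (\<Sum>i\<in>?J. zscale 1 (g i))) = 4 * int k + 4 * (\<Sum>i\<in>?J. 1 * B w (g i)) + 4 * (\<Sum>i\<in>?J. 1\<^sup>2)"
    using w gV gg IJ(3) by (subst orthogonal_frame_qnorm) auto
  also have "(\<Sum>i\<in>?J. 1 * B w (g i)) = (\<Sum>i\<in>?J. - 2)"
    using wg IJ(3) \<open>c = 0\<close> by (intro sum.cong) auto
  finally have "Q (zscale 2 w + ?s) = 0" unfolding sum_constant card by simp
  then have ws: "zscale 2 w + ?s = 0"
    using qnorm_eq_0_iff[of "zscale 2 w + ?s"] w JV by simp
  obtain l where l: "k = 2 * l + 1" using k(1) by (rule oddE)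
  have two: "zscale 2 x = x + x" for x :: 'a using zscale_add_left[of 1 1 x] by simp
  have "?s = (\<Sum>i\<in>?J. t) + (?h + ?h)" by (simp only: g_def sum.distrib)
  also have "(\<Sum>i\<in>?J. t) = zscale (int k) t"
    using zmod.scale_sum_left[of "\<lambda>_. 1" ?J t] card(2) by (simp del: card_atLeastAtMost)
  also have "\<dots> = zscale (int l) t + zscale (int l) t + t"
    by (simp add: l zscale_add_left flip: zscale_add_left[of "int l" "int l"])
  finally have s: "?s = zscale (int l) t + zscale (int l) t + t + (?h + ?h)" .
  \<comment> \<open>Half of \<open>g 1\<close>. As \<open>k = 2 * l + 1\<close>, the sum
    \<open>?s\<close> is \<open>t\<close> plus twice a lattice vector, and so are \<open>g 1\<close>
    and, up to \<open>2 w\<close>, zero; their difference is therefore divisible by 2.\<close>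
  define x where "x = h 1 - w - zscale (int l) t - ?h"
  have xV: "x \<in> V" using h(1) one(1) w t JV by (simp add: x_def)
  have "zscale 2 x = g 1 - (zscale 2 w + ?s)"
    unfolding two x_def s by (simp add: g_def algebra_simps)
  then have "zscale 2 x = g 1" using ws by simp
  then have "4 * Q x = 4" using qnorm_scale[OF xV, of 2] gg[OF one(1) one(1)] by (simp add: qnorm_def)
  then have "Q x = 1" by simp
  then show False using two_le_qnorm[OF xV] by (cases "x = 0") (auto simp: qnorm_def)
qed

end

section \<open>From the representation to the component of the root lattice\<close>

text \<open>A representation is only required to preserve norms; polarization recovers the form,
  using that the form on \<open>M\<close> is the explicit sum of products.\<close>

lemma representation_form:
  assumes "lattice_representation f M N" "zmod.subspace (vectors M)" "x \<in> vectors M" "y \<in> vectors M"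
    and M: "\<And>x y. form M x y = (\<Sum>i=1..n. x i * y i)" and "lattice_min_two N"
  shows "form N (f x) (f y) = form M x y"
proof -
  interpret lattice_min_two N by fact
  note F = assms(1)[unfolded lattice_representation_def]
  have V: "f x \<in> V" "f y \<in> V" using F assms by auto
  have "Q (f (x + y)) = qnorm M (x + y)" using F zmod.subspace_add[OF assms(2-4)] by blast
  moreover have "f (x + y) = f x + f y" using F assms by blast
  ultimately have "Q (f x) + Q (f y) + 2 * B (f x) (f y) = qnorm M (x + y)" using V by (simp add: qnorm_add)
  also have "\<dots> = qnorm M x + qnorm M y + 2 * form M x y"
    by (simp add: qnorm_def M algebra_simps sum.distrib sum_distrib_left)
  finally show ?thesis using F assms(3,4) by simp
qed

theorem theorem4p3:
  fixes n k :: nat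
    and L :: "'a::ab_group_add zlat"
    and \<phi> :: "(nat \<Rightarrow> int) \<Rightarrow> 'a"
  assumes "n > 15"
    and "odd k"
    and "1 < k"
    and "real k < sqrt (real n)"
    and "zlattice L"
    and "min_norm L \<ge> 2"
    and "lattice_representation \<phi> (A_nk n k) L"
  shows "\<exists>m\<ge>n. isometric (root_component L (\<phi> ` vectors (A_chain n))) (root_lattice_A (m - 1))"
proof -
  have min2: "2 \<le> qnorm L x" if x: "x \<in> vectors L" "x \<noteq> 0" for x
  proof -
    let ?S = "{qnorm L x | x. x \<in> vectors L \<and> x \<noteq> 0}"
    \<comment> \<open>An infimum of integers is a lower bound only for a set bounded below, which
      positive definiteness provides.\<close>
    have "bdd_below ?S"
      using assms(5) unfolding zlattice_def by (intro bdd_belowI[of _ 0]) force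
    then have "min_norm L \<le> qnorm L x"
      unfolding min_norm_def using x by (intro cInf_lower) auto
    then show ?thesis using assms(6) by simp
  qed
  interpret lattice_min_two L
    using assms(5) min2 by unfold_locales
  have pos: "lattice_min_two L" by unfold_locales
  have "real k * real k < sqrt (real n) * sqrt (real n)"
    using assms(4) by (intro mult_strict_mono') auto
  then have kk: "k * k < n" by (simp flip: of_nat_mult)
  have k3: "3 \<le> k" using assms(2,3) by (cases "k = 2") auto
  have "k \<le> k * k" using k3 by simp
  then have kn: "k < n" using kk by linarith

  let ?M = "A_nk n k"
  note \<phi> = assms(7)[unfolded lattice_representation_def]
  have sub: "zmod.subspace (vectors ?M)"
    by (simp add: A_nk_def generated_sublattice_def)
  have form_M: "form ?M x y = (\<Sum>i=1..n. x i * y i)" for x y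
    by (simp add: A_nk_def generated_sublattice_def I_lat_def)
  have \<phi>V: "\<phi> x \<in> V" if "x \<in> vectors ?M" for x using \<phi> that by blast
  have \<phi>B: "B (\<phi> x) (\<phi> y) = (\<Sum>i=1..n. x i * y i)" if "x \<in> vectors ?M" "y \<in> vectors ?M" for x y
    using representation_form[OF assms(7) sub that form_M pos] form_M by simp
  have \<phi>_diff: "\<phi> (x - y) = \<phi> x - \<phi> y" if "x \<in> vectors ?M" "y \<in> vectors ?M" for x y
  proof -
    have "\<phi> ((x - y) + y) = \<phi> (x - y) + \<phi> y"
      using \<phi> that zmod.subspace_diff[OF sub] by blast
    then show ?thesis by simp
  qed
  let ?e = std_vec
  let ?chain = "{- ?e i + ?e (i + 1) | i. 1 \<le> i \<and> i < n}"
  have vectors_M: "vectors ?M = zmod.span (?chain \<union> {- (\<Sum>i = n - k + 1..n. ?e i)})"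
    by (simp add: A_nk_def generated_sublattice_def)
  have chain_M: "zmod.span ?chain \<subseteq> vectors ?M"
    unfolding vectors_M by (intro zmod.span_mono Un_upper1)
  \<comment> \<open>The difference telescopes along the chain of generators.\<close>
  have d: "?e i - ?e 1 \<in> vectors ?M" if "i \<in> {1..n}" for i
  proof -
    have "1 \<le> i \<Longrightarrow> i \<le> n \<Longrightarrow> ?e i - ?e 1 \<in> zmod.span ?chain"
    proof (induction i rule: dec_induct)
      case base
      show ?case by (simp only: diff_self zmod.span_zero)
    next
      case (step i)
      then have "i < n" by simp
      then have "?e i - ?e 1 \<in> zmod.span ?chain" using step.IH less_imp_le by blast
      moreover have "- ?e i + ?e (i + 1) \<in> zmod.span ?chain"
        using step.hyps \<open>i < n\<close> by (intro zmod.span_base) blast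
      ultimately have "(?e i - ?e 1) + (- ?e i + ?e (i + 1)) \<in> zmod.span ?chain"
        by (rule zmod.span_add)
      also have "(?e i - ?e 1) + (- ?e i + ?e (i + 1)) = ?e (Suc i) - ?e 1"
        by (simp add: fun_eq_iff)
      finally show ?case .
    qed
    then show ?thesis using that chain_M by auto
  qed
  define w where "w = - (\<Sum>i = n - k + 1..n. ?e i)"
  have wM: "w \<in> vectors ?M"
    unfolding vectors_M w_def by (auto intro: zmod.span_base)
  have w_apply: "w j = (if n - k < j \<and> j \<le> n then - 1 else 0)" for j
    by (auto simp: w_def sum_fun_apply std_vec_def)
  \<comment> \<open>The vectors \<open>e_i\<close> themselves are not in the lattice, whose
    coordinate sums are multiples of \<open>k\<close>; subtracting \<open>e_1\<close> translates the
    simplex so that \<open>h 1\<close> is zero.\<close>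
  define h where "h i = \<phi> (?e i - ?e 1)" for i
  have hV: "h i \<in> V" if "i \<in> {1..n}" for i using d \<phi>V that by (simp add: h_def)
  have hh: "h i - h j = \<phi> (?e i - ?e j)" "?e i - ?e j \<in> vectors ?M"
    if "i \<in> {1..n}" "j \<in> {1..n}" for i j
    using \<phi>_diff[OF d[OF that(1)] d[OF that(2)]] zmod.subspace_diff[OF sub d[OF that(1)] d[OF that(2)]]
    by (simp_all add: h_def)
  have hQ: "Q (h i - h j) = 2" if ij: "i \<in> {1..n}" "j \<in> {1..n}" "i \<noteq> j" for i j
  proof -
    have "Q (h i - h j) = (\<Sum>l=1..n. (?e i - ?e j) l * (?e i - ?e j) l)"
      unfolding qnorm_def hh(1)[OF ij(1,2)] using \<phi>B hh(2)[OF ij(1,2)] by blast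
    also have "\<dots> = (\<Sum>l=1..n. (if l = i then 1 else 0) + (if l = j then 1 else 0))"
      using ij(3) by (intro sum.cong) (auto simp: std_vec_def)
    also have "\<dots> = 2" using ij by (simp add: sum.distrib)
    finally show ?thesis .
  qed
  have Qw: "Q (\<phi> w) = int k"
  proof -
    have "Q (\<phi> w) = (\<Sum>l=1..n. if l \<in> {n - k + 1..n} then 1 else 0)"
      unfolding qnorm_def \<phi>B[OF wM wM] by (intro sum.cong) (auto simp: w_apply)
    also have "\<dots> = int (card ({1..n} \<inter> {n - k + 1..n}))"
      by (subst sum.inter_restrict[symmetric]) auto
    also have "{1..n} \<inter> {n - k + 1..n} = {n - k + 1..n}" by auto
    finally show ?thesis using kn by simp
  qed
  \<comment> \<open>The subtracted \<open>e_1\<close> does not contribute, because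
    \<open>k < n\<close> keeps the first coordinate out of \<open>w\<close>.\<close>
  have wh: "B (\<phi> w) (h i) = - (if n - k < i then 1 else 0)" if "i \<in> {1..n}" for i
  proof -
    have "B (\<phi> w) (h i) = (\<Sum>l=1..n. (if l = i then w i else 0) - (if l = 1 then w 1 else 0))"
      unfolding h_def \<phi>B[OF wM d[OF that]] by (intro sum.cong) (auto simp: std_vec_def)
    also have "\<dots> = w i - w 1" using that by (simp add: sum_subtractf)
    finally show ?thesis using that kn by (simp add: w_apply)
  qed

  have inj: "inj_on h {1..n}"
  proof (rule inj_onI, rule ccontr)
    fix i j assume "i \<in> {1..n}" "j \<in> {1..n}" "h i = h j" "i \<noteq> j"
    then show False using hQ[of i j] by (simp add: qnorm_def)
  qed
  have "simplex (h ` {1..n})"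
    unfolding simplex_def
  proof (intro conjI ballI impI)
    show "h ` {1..n} \<subseteq> V" using hV by blast
    fix x y assume xy: "x \<in> h ` {1..n}" "y \<in> h ` {1..n}" "x \<noteq> y"
    then obtain i j where "x = h i" "y = h j" "i \<in> {1..n}" "j \<in> {1..n}" "i \<noteq> j" by blast
    then show "Q (x - y) = 2" using hQ by blast
  qed
  then obtain H where H: "h ` {1..n} \<subseteq> H" "simplex H" "finite H"
    "\<And>z. z \<notin> H \<Longrightarrow> \<not> simplex (insert z H)"
    by (rule maximal_simplex) blast
  have "n = card (h ` {1..n})" using inj by (simp add: card_image)
  also have "\<dots> \<le> card H" using H by (intro card_mono)
  finally have nH: "n \<le> card H" .
  \<comment> \<open>A vector \<open>t\<close> bad for all of \<open>H\<close> is bad for the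
    \<open>n\<close> original vertices, which are the ones related to \<open>w\<close>.\<close>
  have no_D: "\<exists>z\<in>H. Q (t + (z + z)) \<noteq> 4" if "t \<in> V" for t
  proof (rule ccontr)
    assume "\<not> (\<exists>z\<in>H. Q (t + (z + z)) \<noteq> 4)"
    then have t4: "Q (t + (h i + h i)) = 4" if "i \<in> {1..n}" for i using H(1) that by blast
    have wh1: "B (\<phi> w) (h i) = B (\<phi> w) (h 1) - (if n - k < i then 1 else 0)" if "i \<in> {1..n}" for i
      using wh[OF that] wh[of 1] kn by simp
    show False
      by (rule no_doubled_basis[OF assms(1,2) k3 kk, of h t "\<phi> w"])
        (fact hV hQ \<open>t \<in> V\<close> t4 \<phi>V[OF wM] Qw wh1)+
  qed
  have h12: "h 2 \<in> H" "h 1 \<in> H" "h 2 \<noteq> h 1"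
    using H(1) assms(1) hQ[of 2 1] by (auto simp: qnorm_def)
  have dich: "B r x = B r y" if "r \<in> roots" "r \<notin> diffs H" "x \<in> H" "y \<in> H" for r x y
    using root_in_diffs_or_orthogonal[OF H(2-4) _ no_D that] nH assms(1) by linarith
  have r0: "h 2 - h 1 \<in> roots" "zmod.span (root_class (h 2 - h 1)) = zmod.span (diffs H)"
    by (rule span_root_class_simplex[OF H(2) h12]; fact dich)+
  have vectors_chain: "vectors (A_chain n) = zmod.span ?chain"
    by (simp add: A_chain_def generated_sublattice_def)
  have r0_eq: "h 2 - h 1 = \<phi> (- ?e 1 + ?e (1 + 1))"
    using hh(1)[of 2 1] assms(1) by (simp add: numeral_2_eq_2)
  have "\<phi> x \<in> zmod.span (diffs H)" if "x \<in> zmod.span ?chain" for x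
  proof -
    \<comment> \<open>The preimage of the span of the edges is a subspace, so it suffices to check
      the generators of the chain.\<close>
    let ?U = "{x \<in> vectors ?M. \<phi> x \<in> zmod.span (diffs H)}"
    have "\<phi> 0 = 0" using \<phi>_diff[OF zmod.subspace_0[OF sub] zmod.subspace_0[OF sub]] by simp
    then have "zmod.subspace ?U"
      using \<phi> zmod.subspace_0[OF sub] zmod.subspace_add[OF sub] zmod.subspace_scale[OF sub]
      by (auto simp: zmod.subspace_def intro: zmod.span_zero zmod.span_add zmod.span_scale)
    moreover have "?chain \<subseteq> ?U"
    proof
      fix x assume "x \<in> ?chain"
      then obtain i where i: "x = ?e (i + 1) - ?e i" "1 \<le> i" "i < n" by auto
      then have "h (i + 1) - h i = \<phi> x" "x \<in> vectors ?M" using hh[of "i + 1" i] by auto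
      moreover have "h (i + 1) \<in> H" "h i \<in> H" using H(1) i by auto
      then have "h (i + 1) - h i \<in> diffs H" unfolding diffs_def by blast
      ultimately show "x \<in> ?U" by (auto intro: zmod.span_base)
    qed
    ultimately show ?thesis using zmod.span_minimal[of ?chain ?U] that by blast
  qed
  then have sub_K: "\<phi> ` vectors (A_chain n) \<subseteq> zmod.span (root_class (h 2 - h 1))"
    unfolding r0(2) vectors_chain by blast
  have "- ?e 1 + ?e (1 + 1) \<in> ?chain"
    using assms(1) by (intro CollectI exI[of _ 1]) simp
  then have "h 2 - h 1 \<in> \<phi> ` vectors (A_chain n)"
    unfolding r0_eq vectors_chain by (intro imageI zmod.span_base)
  then have "root_component L (\<phi> ` vectors (A_chain n)) = class_lattice (h 2 - h 1)"
    using sub_K by (rule root_component_eq[OF r0(1)])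
  moreover have "isometric (class_lattice (h 2 - h 1)) (root_lattice_A (card H - 1))"
  proof (rule isometric_simplex[OF H(2,3)])
    show "H \<noteq> {}" using h12 by blast
  qed (simp_all only: class_lattice_simps r0(2))
  ultimately show ?thesis using nH by metis
qed

end
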